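(* Let $d\ge 1$ and $n\ge d+2$ be integers with $(d,n)\neq(2,4)$. Then every linear automorphism ${\bf A}$ of $L_{d,n}$ is a scalar multiple of a signed permutation induced by a vertex relabeling; that is, ${\bf A}=c\,{\bf S}{\bf P}$ for some $c\in\mathbb C\setminus\{0\}$, some diagonal matrix ${\bf S}$ with diagonal entries in $\{1,-1\}$, and some permutation matrix ${\bf P}$ that maps each coordinate vector $e_{\{i,j\}}$ to $e_{\{\sigma(i),\sigma(j)\}}$ for a fixed permutation $\sigma$ of $\{1,\dots,n\}$.
   Context: Let $N=\binom{n}{2}$ and index the coordinates of $\mathbb C^N$ by the edges $\{i,j\}$ ($1\le i<j\le n$) of the complete graph $K_n$. For a complex configuration ${\bf p}=({\bf p}_1,\dots,{\bf p}_n)$ of points in $\mathbb C^d$, let $m({\bf p})\in\mathbb C^N$ have coordinates $m_{ij}({\bf p})=\sum_{k=1}^d({\bf p}_i^k-{\bf p}_j^k)^2$ (no complex conjugation). The squared measurement variety $M_{d,n}\subset\mathbb C^N$ is the image of $m$ over all complex configurations. Let $s:\mathbb C^N\to\mathbb C^N$ square each coordinate; the unsquared measurement variety is $L_{d,n}=s^{-1}(M_{d,n})$. A linear automorphism of a variety $V\subset\mathbb C^N$ is a non-singular $N\times N$ complex matrix ${\bf A}$ mapping $V$ bijectively onto itself. *)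

theory Defs
  imports "HOL-Analysis.Analysis" "HOL-Combinatorics.Permutations"
begin

text \<open>Vertices of K_n are 0,...,n-1; an edge {i,j} with i<j is the pair (i,j).
Vectors of C^N are functions on pairs that vanish off the edge set;
an N x N matrix is a function on pairs of edges (entries off edges are irrelevant).\<close>

definition edges :: "nat \<Rightarrow> (nat \<times> nat) set" where
  "edges n = {(i, j). i < j \<and> j < n}"

definition vecs :: "nat \<Rightarrow> (nat \<times> nat \<Rightarrow> complex) set" where
  "vecs n = {v. \<forall>e. e \<notin> edges n \<longrightarrow> v e = 0}"

definition meas :: "nat \<Rightarrow> nat \<Rightarrow> (nat \<Rightarrow> nat \<Rightarrow> complex) \<Rightarrow> (nat \<times> nat \<Rightarrow> complex)" where
  "meas d n p = (\<lambda>(i, j). if (i, j) \<in> edges n then (\<Sum>k<d. (p i k - p j k)^2) else 0)"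

definition sq_meas_variety :: "nat \<Rightarrow> nat \<Rightarrow> (nat \<times> nat \<Rightarrow> complex) set" where
  "sq_meas_variety d n = range (meas d n)"

definition unsq_meas_variety :: "nat \<Rightarrow> nat \<Rightarrow> (nat \<times> nat \<Rightarrow> complex) set" where
  "unsq_meas_variety d n = {v \<in> vecs n. (\<lambda>e. (v e)^2) \<in> sq_meas_variety d n}"

definition mat_apply :: "nat \<Rightarrow> (nat \<times> nat \<Rightarrow> nat \<times> nat \<Rightarrow> complex) \<Rightarrow> (nat \<times> nat \<Rightarrow> complex) \<Rightarrow> (nat \<times> nat \<Rightarrow> complex)" where
  "mat_apply n A v = (\<lambda>e. if e \<in> edges n then (\<Sum>f\<in>edges n. A e f * v f) else 0)"

definition nonsingular :: "nat \<Rightarrow> (nat \<times> nat \<Rightarrow> nat \<times> nat \<Rightarrow> complex) \<Rightarrow> bool" where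
  "nonsingular n A \<longleftrightarrow> (\<forall>v \<in> vecs n. mat_apply n A v = (\<lambda>_. 0) \<longrightarrow> v = (\<lambda>_. 0))"

definition linear_automorphism :: "nat \<Rightarrow> (nat \<times> nat \<Rightarrow> complex) set \<Rightarrow> (nat \<times> nat \<Rightarrow> nat \<times> nat \<Rightarrow> complex) \<Rightarrow> bool" where
  "linear_automorphism n V A \<longleftrightarrow> nonsingular n A \<and> bij_betw (mat_apply n A) V V"

definition relabel_edge :: "(nat \<Rightarrow> nat) \<Rightarrow> nat \<times> nat \<Rightarrow> nat \<times> nat" where
  "relabel_edge \<sigma> e = (min (\<sigma> (fst e)) (\<sigma> (snd e)), max (\<sigma> (fst e)) (\<sigma> (snd e)))"

end

theory Submission
  imports Defs "HOL-Library.Function_Algebras" "HOL-Computational_Algebra.Polynomial"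
begin

text \<open>
  Call a vector a star with center \<open>z\<close> if its square is a non-zero constant on the edges at \<open>z\<close> and zero
  elsewhere. Stars are singled out by a linearly invariant property: if \<open>F\<close> is a homogeneous polynomial of degree
  \<open>2d + 2\<close> vanishing on \<open>L\<^bsub>d,n\<^esub>\<close>, then \<open>s \<mapsto> F(w + s v)\<close> has degree at most 2 for every \<open>w\<close>. Indeed
  invariance under sign changes makes \<open>F\<close> a polynomial \<open>g\<close> of degree \<open>d + 1\<close> in the squares; since \<open>g\<close> vanishes on
  sums of \<open>d\<close> squared one-dimensional measurements, it is affine along each such measurement, and a line in the
  direction of a star becomes, after squaring, \<open>x + D(s u - b)\<close> with a quadratic map \<open>D\<close> to these measurements.
  Conversely, testing the property on Cayley--Menger determinants, reduced to 2, 3 or 4 vertices by extracting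
  leading coefficients in the lengths of disjoint edges, leaves no other vectors.

  Hence an automorphism permutes the stars. If \<open>d = 1\<close>, two stars have different centers precisely when their span
  lies in the variety (unless they are proportional); if \<open>n \<ge> 5\<close>, a relation between four stars \<open>x\<^sub>1 - x\<^sub>2 = x\<^sub>3 - x\<^sub>4\<close>
  forces their centers to pair up. In both cases stars with a common center are mapped to stars with a common center,
  so the span of the edges at \<open>z\<close> goes to the span of the edges at some \<open>\<sigma> z\<close>. Intersecting these spans for two
  vertices, every coordinate vector \<open>e\<^bsub>ij\<^esub>\<close> goes to a multiple of \<open>e\<^bsub>\<sigma>i \<sigma>j\<^esub>\<close>, and the squares of these multiples
  agree because the image of a star is a star.
\<close>

section \<open>Finite differences and univariate polynomials\<close>

text \<open>All \<open>k\<close>-fold mixed finite differences vanish; for a polynomial function this says that its degree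
  is less than \<open>k\<close>.\<close>

primrec diff_vanish :: "nat \<Rightarrow> ('a::ab_group_add \<Rightarrow> complex) \<Rightarrow> bool" where
  "diff_vanish 0 g \<longleftrightarrow> (\<forall>x. g x = 0)"
| "diff_vanish (Suc k) g \<longleftrightarrow> (\<forall>h. diff_vanish k (\<lambda>x. g (x + h) - g x))"

lemma diff_vanish_SucI: "(\<And>h. diff_vanish k (\<lambda>x. g (x + h) - g x)) \<Longrightarrow> diff_vanish (Suc k) g"
  by simp

lemma diff_vanish_SucD: "diff_vanish (Suc k) g \<Longrightarrow> diff_vanish k (\<lambda>x. g (x + h) - g x)"
  by simp

lemma diff_vanish_zero: "diff_vanish k (\<lambda>x. 0)"
  by (induction k) auto

lemma diff_vanish_add: "diff_vanish k f \<Longrightarrow> diff_vanish k g \<Longrightarrow> diff_vanish k (\<lambda>x. f x + g x)"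
proof (induction k arbitrary: f g)
  case (Suc k)
  have "diff_vanish k (\<lambda>x. (f (x + h) - f x) + (g (x + h) - g x))" for h
    using Suc by simp
  then show ?case by (simp add: algebra_simps)
qed simp

lemma diff_vanish_sum: "(\<And>i. i \<in> I \<Longrightarrow> diff_vanish k (f i)) \<Longrightarrow> diff_vanish k (\<lambda>x. \<Sum>i\<in>I. f i x)"
  by (induction I rule: infinite_finite_induct) (auto simp: diff_vanish_zero intro!: diff_vanish_add)

lemma diff_vanish_cmult: "diff_vanish k f \<Longrightarrow> diff_vanish k (\<lambda>x. c * f x)"
proof (induction k arbitrary: f)
  case (Suc k)
  have "diff_vanish k (\<lambda>x. c * (f (x + h) - f x))" for h
    using Suc by simp
  then show ?case by (simp add: algebra_simps)
qed simp

lemma diff_vanish_shift: "diff_vanish k f \<Longrightarrow> diff_vanish k (\<lambda>x. f (x + a))"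
proof (induction k arbitrary: f)
  case (Suc k)
  show ?case
    unfolding diff_vanish.simps
  proof
    fix h
    have "diff_vanish k (\<lambda>x. f (x + h) - f x)" using Suc.prems by simp
    from Suc.IH[OF this] show "diff_vanish k (\<lambda>x. f (x + h + a) - f (x + a))"
      by (simp add: ac_simps)
  qed
qed simp

lemma diff_vanish_Suc: "diff_vanish k f \<Longrightarrow> diff_vanish (Suc k) f"
proof (induction k arbitrary: f)
  case (Suc k)
  then show ?case using diff_vanish_SucI Suc.IH diff_vanish_SucD by meson
qed simp

text \<open>By the product rule, the difference of \<open>\<xi> x * f x\<close> is
  \<open>\<xi> x\<close> times a difference of \<open>f\<close> plus the constant
  \<open>\<xi> h\<close> times a shift of \<open>f\<close>; an additive factor thus raises the
  degree by at most one.\<close>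

lemma diff_vanish_additive_mult:
  assumes "\<And>x y. \<xi> (x + y) = \<xi> x + \<xi> y"
  shows "diff_vanish k f \<Longrightarrow> diff_vanish (Suc k) (\<lambda>x. \<xi> x * f x)"
proof (induction k arbitrary: f)
  case (Suc k)
  show ?case
    unfolding diff_vanish.simps(2)[of "Suc k"]
  proof
    fix h
    have "diff_vanish (Suc k) (\<lambda>x. \<xi> x * (f (x + h) - f x))"
      by (rule Suc.IH[OF diff_vanish_SucD[OF Suc.prems]])
    moreover have "diff_vanish (Suc k) (\<lambda>x. \<xi> h * f (x + h))"
      by (intro diff_vanish_cmult diff_vanish_shift Suc.prems)
    ultimately have "diff_vanish (Suc k) (\<lambda>x. \<xi> x * (f (x + h) - f x) + \<xi> h * f (x + h))"
      by (rule diff_vanish_add)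
    then show "diff_vanish (Suc k) (\<lambda>x. \<xi> (x + h) * f (x + h) - \<xi> x * f x)"
      by (simp add: assms algebra_simps)
  qed
qed simp

text \<open>The difference in a direction from \<open>S\<close> has lower degree and vanishes on
  sums with one summand fewer, hence on all sums by induction. So adding an element of
  \<open>S\<close> never changes the value, and every sum has the value of the empty sum.\<close>

lemma diff_vanish_vanish_on_sums:
  assumes "diff_vanish k g"
    and "\<And>xs. set xs \<subseteq> S \<Longrightarrow> length xs < k \<Longrightarrow> g (sum_list xs) = 0"
    and "set xs \<subseteq> S"
  shows "g (sum_list xs) = 0"
  using assms
proof (induction k arbitrary: g xs)
  case (Suc k)
  have step: "g (sum_list ys + a) = g (sum_list ys)" if "a \<in> S" "set ys \<subseteq> S" for a ys
  proof -
    have "g (sum_list ys + a) - g (sum_list ys) = 0"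
    proof (rule Suc.IH[where g = "\<lambda>x. g (x + a) - g x"])
      show "diff_vanish k (\<lambda>x. g (x + a) - g x)" using Suc.prems(1) by simp
      fix zs assume "set zs \<subseteq> S" "length zs < k"
      then show "g (sum_list zs + a) - g (sum_list zs) = 0"
        using Suc.prems(2)[of zs] Suc.prems(2)[of "a # zs"] that(1) by (simp add: add.commute)
    qed (use that in auto)
    then show ?thesis by simp
  qed
  from Suc.prems(3) show ?case
  proof (induction xs)
    case Nil
    then show ?case using Suc.prems(2)[of "[]"] by simp
  next
    case (Cons a xs)
    then show ?case using step[of a xs] by (simp add: add.commute)
  qed
qed simp

section \<open>Univariate polynomial functions and their degrees\<close>

definition deg_le :: "nat \<Rightarrow> (complex \<Rightarrow> complex) \<Rightarrow> bool" where
  "deg_le m h \<longleftrightarrow> (\<exists>p. degree p \<le> m \<and> (\<forall>s. h s = poly p s))"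

definition ispoly :: "(complex \<Rightarrow> complex) \<Rightarrow> bool" where
  "ispoly h \<longleftrightarrow> (\<exists>p. \<forall>s. h s = poly p s)"

lemma deg_le_add: "deg_le m f \<Longrightarrow> deg_le m g \<Longrightarrow> deg_le m (\<lambda>s. f s + g s)"
  unfolding deg_le_def by (metis degree_add_le poly_add)

lemma deg_le_cmult: "deg_le m f \<Longrightarrow> deg_le m (\<lambda>s. c * f s)"
  unfolding deg_le_def by (metis degree_smult_le order_trans poly_smult)

lemma ispoly_const: "ispoly (\<lambda>s. c)"
  unfolding ispoly_def by (intro exI[of _ "[:c:]"]) simp

lemma ispoly_id: "ispoly (\<lambda>s. s)"
  unfolding ispoly_def by (intro exI[of _ "[:0, 1:]"]) simp

lemma ispoly_add: "ispoly f \<Longrightarrow> ispoly g \<Longrightarrow> ispoly (\<lambda>s. f s + g s)"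
  unfolding ispoly_def by (metis poly_add)

lemma ispoly_diff: "ispoly f \<Longrightarrow> ispoly g \<Longrightarrow> ispoly (\<lambda>s. f s - g s)"
  unfolding ispoly_def by (metis poly_diff)

lemma ispoly_mult: "ispoly f \<Longrightarrow> ispoly g \<Longrightarrow> ispoly (\<lambda>s. f s * g s)"
  unfolding ispoly_def by (metis poly_mult)

lemma ispoly_power: "ispoly f \<Longrightarrow> ispoly (\<lambda>s. f s ^ k)"
  unfolding ispoly_def by (metis poly_power)

lemma ispoly_sum: "(\<And>i. i \<in> I \<Longrightarrow> ispoly (f i)) \<Longrightarrow> ispoly (\<lambda>s. \<Sum>i\<in>I. f i s)"
  by (induction I rule: infinite_finite_induct) (auto intro: ispoly_const ispoly_add)

lemma ispoly_prod: "(\<And>i. i \<in> I \<Longrightarrow> ispoly (f i)) \<Longrightarrow> ispoly (\<lambda>s. \<Prod>i\<in>I. f i s)"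
  by (induction I rule: infinite_finite_induct) (auto intro: ispoly_const ispoly_mult)

lemmas ispoly_intros = ispoly_const ispoly_id ispoly_add ispoly_diff ispoly_mult ispoly_power
  ispoly_sum ispoly_prod

text \<open>Polynomials form an integral domain. This extends identities from the points of a curve
  where \<open>g\<close> is non-zero to the whole curve.\<close>

lemma ispoly_zero_product:
  assumes "ispoly f" "ispoly g" "\<And>s. f s * g s = 0" "g s0 \<noteq> 0"
  shows "f s = 0"
proof -
  obtain p q where p: "\<And>s. f s = poly p s" and q: "\<And>s. g s = poly q s"
    using assms(1,2) unfolding ispoly_def by metis
  have "poly (p * q) = poly 0" using assms(3) p q by (auto simp: fun_eq_iff)
  then have "p * q = 0" using poly_eq_poly_eq_iff by blast
  moreover have "q \<noteq> 0" using assms(4) q by auto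
  ultimately show ?thesis using p by simp
qed

text \<open>The functional equation fixes the values at the natural numbers as those of an affine
  function, and infinitely many values determine a polynomial.\<close>

lemma ispoly_additive_linear:
  assumes "ispoly f" "\<And>a b. f (a + b) - f a - f b + f 0 = 0"
  shows "f y = f 0 + y * (f 1 - f 0)"
proof -
  obtain p where p: "\<And>s. f s = poly p s" using assms(1) unfolding ispoly_def by metis
  have eq: "f (a + b) = f a + f b - f 0" for a b
    using assms(2)[of a b] by (simp add: algebra_simps)
  have "f (of_nat n) = f 0 + of_nat n * (f 1 - f 0)" for n
  proof (induction n)
    case (Suc n)
    have "f (of_nat (Suc n)) = f 1 + f (of_nat n) - f 0" using eq[of 1 "of_nat n"] by simp
    also have "\<dots> = f 0 + of_nat (Suc n) * (f 1 - f 0)" by (subst Suc) (simp add: algebra_simps)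
    finally show ?case .
  qed simp
  then have "range of_nat \<subseteq> {x. poly (p - [:f 0, f 1 - f 0:]) x = 0}"
    by (auto simp: p)
  moreover have "infinite (range (of_nat :: nat \<Rightarrow> complex))"
    using inj_of_nat by (rule range_inj_infinite)
  ultimately have "p - [:f 0, f 1 - f 0:] = 0"
    using poly_roots_finite finite_subset by blast
  then have "poly p y = poly [:f 0, f 1 - f 0:] y" by simp
  then show ?thesis by (simp add: p)
qed

text \<open>The expression \<open>s^2 * g (1 / s)\<close> contains no power of \<open>s\<close>
  above the second, and a polynomial that equals it inherits this.\<close>

lemma deg_le_2_reversal:
  assumes "ispoly f" "ispoly g" "\<And>s. s \<noteq> 0 \<Longrightarrow> f s = s^2 * g (1 / s)"
  shows "deg_le 2 f"
proof -
  obtain p q where p: "\<And>s. f s = poly p s" and q: "\<And>s. g s = poly q s"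
    using assms(1,2) unfolding ispoly_def by metis
  let ?m = "degree q"
  \<comment> \<open>One factor \<open>s\<close> more than is needed to clear the denominators makes
    both sides vanish at 0, where the hypothesis is silent.\<close>
  have "poly (p * monom 1 (Suc ?m)) s = poly (monom 1 3 * reflect_poly q) s" for s
  proof (cases "s = 0")
    case False
    have "poly p s = s^2 * poly q (inverse s)"
      using assms(3)[OF False] p q by (simp add: inverse_eq_divide)
    with False show ?thesis
      by (simp add: poly_monom poly_reflect_poly_nz power3_eq_cube power2_eq_square)
  qed (simp add: poly_monom)
  then have eq: "p * monom 1 (Suc ?m) = monom 1 3 * reflect_poly q"
    using poly_eq_poly_eq_iff by blast
  have "degree p \<le> 2"
  proof (cases "p = 0")
    case False
    have "degree p + Suc ?m = degree (p * monom 1 (Suc ?m))"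
      using False by (subst degree_mult_eq) (auto simp: degree_monom_eq monom_eq_0_iff)
    also have "\<dots> \<le> degree (monom (1::complex) 3) + degree (reflect_poly q)"
      unfolding eq by (rule degree_mult_le)
    also have "\<dots> \<le> 3 + ?m"
      using degree_reflect_poly_le[of q] by (simp add: degree_monom_eq)
    finally show ?thesis by simp
  qed simp
  then show ?thesis unfolding deg_le_def using p by blast
qed

section \<open>Homogeneous polynomials on coordinate functions\<close>

text \<open>Homogeneous polynomial functions, described by splitting off one variable at a time.
  This replaces a type of multivariate polynomials and turns the basic closure properties into
  inductions on the degree.\<close>

primrec hom_poly :: "'e set \<Rightarrow> nat \<Rightarrow> (('e \<Rightarrow> complex) \<Rightarrow> complex) \<Rightarrow> bool" where
  "hom_poly E 0 F \<longleftrightarrow> (\<exists>c. \<forall>l. F l = c)"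
| "hom_poly E (Suc k) F \<longleftrightarrow> (\<exists>G. (\<forall>e\<in>E. hom_poly E k (G e)) \<and> (\<forall>l. F l = (\<Sum>e\<in>E. l e * G e l)))"

lemma hom_poly_SucI: "(\<And>e. e \<in> E \<Longrightarrow> hom_poly E k (G e)) \<Longrightarrow> hom_poly E (Suc k) (\<lambda>l. \<Sum>e\<in>E. l e * G e l)"
  by auto

lemma hom_poly_SucE:
  assumes "hom_poly E (Suc k) F"
  obtains G where "\<And>e. e \<in> E \<Longrightarrow> hom_poly E k (G e)" "F = (\<lambda>l. \<Sum>e\<in>E. l e * G e l)"
  using assms by (auto simp: fun_eq_iff)

lemma hom_poly_const: "hom_poly E 0 (\<lambda>l. c)"
  by simp

lemma hom_poly_zero: "hom_poly E k (\<lambda>l. 0)"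
  by (induction k) (auto intro!: exI[of _ "\<lambda>e l. 0"])

lemma hom_poly_add: "hom_poly E k F \<Longrightarrow> hom_poly E k G \<Longrightarrow> hom_poly E k (\<lambda>l. F l + G l)"
proof (induction k arbitrary: F G)
  case (Suc k)
  obtain F' where F': "\<And>e. e \<in> E \<Longrightarrow> hom_poly E k (F' e)" "F = (\<lambda>l. \<Sum>e\<in>E. l e * F' e l)"
    using Suc.prems(1) by (rule hom_poly_SucE) blast
  obtain G' where G': "\<And>e. e \<in> E \<Longrightarrow> hom_poly E k (G' e)" "G = (\<lambda>l. \<Sum>e\<in>E. l e * G' e l)"
    using Suc.prems(2) by (rule hom_poly_SucE) blast
  have "hom_poly E (Suc k) (\<lambda>l. \<Sum>e\<in>E. l e * (F' e l + G' e l))"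
    by (intro hom_poly_SucI Suc.IH F'(1) G'(1))
  then show ?case by (simp only: F'(2) G'(2) distrib_left sum.distrib)
qed auto

lemma hom_poly_sum: "(\<And>i. i \<in> I \<Longrightarrow> hom_poly E k (F i)) \<Longrightarrow> hom_poly E k (\<lambda>l. \<Sum>i\<in>I. F i l)"
  by (induction I rule: infinite_finite_induct) (auto simp del: hom_poly.simps intro: hom_poly_zero hom_poly_add)

lemma hom_poly_mult: "hom_poly E j F \<Longrightarrow> hom_poly E k G \<Longrightarrow> hom_poly E (j + k) (\<lambda>l. F l * G l)"
proof (induction j arbitrary: F)
  case 0
  then obtain c where c: "F = (\<lambda>l. c)" by (auto simp: fun_eq_iff)
  from \<open>hom_poly E k G\<close> have "hom_poly E k (\<lambda>l. c * G l)"
  proof (induction k arbitrary: G)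
    case (Suc k)
    obtain G' where G': "\<And>e. e \<in> E \<Longrightarrow> hom_poly E k (G' e)" "G = (\<lambda>l. \<Sum>e\<in>E. l e * G' e l)"
      using Suc.prems by (rule hom_poly_SucE) blast
    have "hom_poly E (Suc k) (\<lambda>l. \<Sum>e\<in>E. l e * (c * G' e l))"
      by (intro hom_poly_SucI Suc.IH G'(1))
    then show ?case by (simp only: G'(2) sum_distrib_left mult.left_commute)
  qed auto
  then show ?case by (simp only: c add_0)
next
  case (Suc j)
  obtain F' where F': "\<And>e. e \<in> E \<Longrightarrow> hom_poly E j (F' e)" "F = (\<lambda>l. \<Sum>e\<in>E. l e * F' e l)"
    using Suc.prems(1) by (rule hom_poly_SucE) blast
  have "hom_poly E (Suc (j + k)) (\<lambda>l. \<Sum>e\<in>E. l e * (F' e l * G l))"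
    by (intro hom_poly_SucI Suc.IH F'(1) Suc.prems(2))
  then show ?case by (simp only: F'(2) sum_distrib_right mult.assoc add_Suc)
qed

lemma hom_poly_cmult: "hom_poly E k F \<Longrightarrow> hom_poly E k (\<lambda>l. c * F l)"
  using hom_poly_mult[OF hom_poly_const] by (metis add_0)

lemma hom_poly_diff: "hom_poly E k F \<Longrightarrow> hom_poly E k G \<Longrightarrow> hom_poly E k (\<lambda>l. F l - G l)"
  using hom_poly_add[of E k F "\<lambda>l. - 1 * G l"] hom_poly_cmult[of E k G "- 1"] by simp

lemma hom_poly_prod:
  "finite I \<Longrightarrow> (\<And>i. i \<in> I \<Longrightarrow> hom_poly E k (F i)) \<Longrightarrow> hom_poly E (k * card I) (\<lambda>l. \<Prod>i\<in>I. F i l)"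
proof (induction I rule: finite_induct)
  case (insert i I)
  have "hom_poly E (k + k * card I) (\<lambda>l. F i l * (\<Prod>i\<in>I. F i l))"
    using insert by (intro hom_poly_mult) auto
  then show ?case using insert.hyps by simp
qed simp

lemma hom_poly_linear: "finite E \<Longrightarrow> hom_poly E (Suc 0) (\<lambda>l. \<Sum>e\<in>E. l e * c e)"
  by (auto intro!: exI[of _ "\<lambda>e l. c e"])

lemma hom_poly_coord: "finite E \<Longrightarrow> e \<in> E \<Longrightarrow> hom_poly E (Suc 0) (\<lambda>l. l e)"
  using hom_poly_linear[of E "\<lambda>f. if f = e then 1 else 0"] by (simp del: hom_poly.simps add: if_distrib cong: if_cong)

text \<open>Expanding each split-off variable by linearity keeps the degree. Test polynomials can
  therefore be pulled back along an automorphism.\<close>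

lemma hom_poly_compose_linear:
  assumes "\<And>l e. e \<in> E \<Longrightarrow> T l e = (\<Sum>f\<in>E. A e f * l f)"
  shows "hom_poly E k F \<Longrightarrow> hom_poly E k (\<lambda>l. F (T l))"
proof (induction k arbitrary: F)
  case (Suc k)
  obtain G where G: "\<And>e. e \<in> E \<Longrightarrow> hom_poly E k (G e)" "F = (\<lambda>l. \<Sum>e\<in>E. l e * G e l)"
    using Suc.prems by (rule hom_poly_SucE) blast
  have "F (T l) = (\<Sum>f\<in>E. l f * (\<Sum>e\<in>E. A e f * G e (T l)))" for l
  proof -
    have "F (T l) = (\<Sum>e\<in>E. \<Sum>f\<in>E. A e f * l f * G e (T l))"
      by (simp add: G(2) assms sum_distrib_right)
    also have "\<dots> = (\<Sum>f\<in>E. \<Sum>e\<in>E. A e f * l f * G e (T l))"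
      by (rule sum.swap)
    finally show ?thesis by (simp add: sum_distrib_left mult_ac)
  qed
  moreover have "hom_poly E (Suc k) (\<lambda>l. \<Sum>f\<in>E. l f * (\<Sum>e\<in>E. A e f * G e (T l)))"
    by (intro hom_poly_SucI hom_poly_sum hom_poly_cmult Suc.IH G(1))
  ultimately show ?case by simp
qed auto

text \<open>Vanishing finite differences alone do not make a function polynomial: complex
  conjugation is additive. Polynomial behaviour along polynomial curves supplies what is
  missing.\<close>

definition polyfun :: "(('e \<Rightarrow> complex) \<Rightarrow> complex) \<Rightarrow> bool" where
  "polyfun g \<longleftrightarrow> (\<forall>\<gamma>. (\<forall>e. ispoly (\<lambda>s. \<gamma> s e)) \<longrightarrow> ispoly (\<lambda>s. g (\<gamma> s)))"

lemma polyfunD: "polyfun g \<Longrightarrow> (\<And>e. ispoly (\<lambda>s. \<gamma> s e)) \<Longrightarrow> ispoly (\<lambda>s. g (\<gamma> s))"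
  unfolding polyfun_def by blast

text \<open>Grouping the monomials by the set of coordinates that occur to an odd power.\<close>

lemma hom_poly_parity_decomposition:
  assumes "finite E"
  shows "hom_poly E k F \<Longrightarrow> \<exists>g. (\<forall>\<kappa>\<in>Pow E. diff_vanish ((k + 2 - card \<kappa>) div 2) (g \<kappa>) \<and> polyfun (g \<kappa>)) \<and>
    (\<forall>l. F l = (\<Sum>\<kappa>\<in>Pow E. (\<Prod>e\<in>\<kappa>. l e) * g \<kappa> (\<lambda>e. (l e)^2)))"
proof (induction k arbitrary: F)
  case 0
  then obtain c where c: "F = (\<lambda>l. c)" by (auto simp: fun_eq_iff)
  let ?g = "\<lambda>\<kappa>::'a set. if \<kappa> = {} then (\<lambda>x. c) else (\<lambda>x. 0)"
  have 1: "diff_vanish ((0 + 2 - card \<kappa>) div 2) (?g \<kappa>) \<and> polyfun (?g \<kappa>)" if "\<kappa> \<in> Pow E" for \<kappa>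
    using that assms by (auto simp: diff_vanish_zero polyfun_def ispoly_const)
  have 2: "F l = (\<Sum>\<kappa>\<in>Pow E. (\<Prod>e\<in>\<kappa>. l e) * ?g \<kappa> (\<lambda>e. (l e)^2))" for l
  proof -
    have "(\<Sum>\<kappa>\<in>Pow E. (\<Prod>e\<in>\<kappa>. l e) * ?g \<kappa> (\<lambda>e. (l e)^2)) = (\<Sum>\<kappa>\<in>Pow E. if \<kappa> = {} then c else 0)"
      by (rule sum.cong) auto
    also have "\<dots> = c" using assms by simp
    finally show ?thesis by (simp add: c)
  qed
  show ?case
    by (rule exI[of _ ?g], rule conjI[OF ballI allI], erule 1, rule 2)
next
  case (Suc k)
  obtain G where G: "\<And>e. e \<in> E \<Longrightarrow> hom_poly E k (G e)" "F = (\<lambda>l. \<Sum>e\<in>E. l e * G e l)"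
    using Suc.prems by (rule hom_poly_SucE) blast
  have "\<forall>e\<in>E. \<exists>g. (\<forall>\<kappa>\<in>Pow E. diff_vanish ((k + 2 - card \<kappa>) div 2) (g \<kappa>) \<and> polyfun (g \<kappa>)) \<and>
    (\<forall>l. G e l = (\<Sum>\<kappa>\<in>Pow E. (\<Prod>e\<in>\<kappa>. l e) * g \<kappa> (\<lambda>e. (l e)^2)))"
    using Suc.IH G(1) by blast
  then obtain g where g0: "\<forall>e\<in>E. (\<forall>\<kappa>\<in>Pow E. diff_vanish ((k + 2 - card \<kappa>) div 2) (g e \<kappa>) \<and> polyfun (g e \<kappa>)) \<and>
    (\<forall>l. G e l = (\<Sum>\<kappa>\<in>Pow E. (\<Prod>e\<in>\<kappa>. l e) * g e \<kappa> (\<lambda>e. (l e)^2)))"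
    by (rule bchoice[THEN exE])
  have g: "\<And>e \<kappa>. e \<in> E \<Longrightarrow> \<kappa> \<subseteq> E \<Longrightarrow> diff_vanish ((k + 2 - card \<kappa>) div 2) (g e \<kappa>)"
      "\<And>e \<kappa>. e \<in> E \<Longrightarrow> \<kappa> \<subseteq> E \<Longrightarrow> polyfun (g e \<kappa>)"
      "\<And>e l. e \<in> E \<Longrightarrow> G e l = (\<Sum>\<kappa>\<in>Pow E. (\<Prod>e\<in>\<kappa>. l e) * g e \<kappa> (\<lambda>e. (l e)^2))"
    using g0 by blast+
  \<comment> \<open>Multiplication by \<open>l e\<close> toggles whether \<open>e\<close> is an odd
    coordinate: it either enters the set, or leaves it together with a factor
    \<open>(l e)^2\<close>, which becomes \<open>x e\<close>. The term for \<open>\<kappa>\<close>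
    comes from the set with \<open>e\<close> toggled.\<close>
  define h where "h e \<kappa> = (if e \<in> \<kappa> then g e (\<kappa> - {e}) else (\<lambda>x. x e * g e (insert e \<kappa>) x))" for e \<kappa>
  \<comment> \<open>The order \<open>(k + 2 - card \<kappa>) div 2\<close> is one more than the
    degree in the squares that the factors in \<open>\<kappa>\<close> leave room for.\<close>
  have fdh: "diff_vanish ((Suc k + 2 - card \<kappa>) div 2) (h e \<kappa>)" if "e \<in> E" "\<kappa> \<subseteq> E" for e \<kappa>
  proof (cases "e \<in> \<kappa>")
    case True
    have fin: "finite \<kappa>" using that assms finite_subset by blast
    have "card \<kappa> > 0" using True fin card_gt_0_iff by blast
    then have "k + 2 - card (\<kappa> - {e}) = Suc k + 2 - card \<kappa>"
      using True fin by simp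
    then show ?thesis using g(1)[of e "\<kappa> - {e}"] that True by (auto simp: h_def)
  next
    case False
    have fin: "finite \<kappa>" using that assms finite_subset by blast
    then have *: "card (insert e \<kappa>) = Suc (card \<kappa>)" using False by simp
    have fdg: "diff_vanish ((k + 2 - Suc (card \<kappa>)) div 2) (g e (insert e \<kappa>))"
      using g(1)[of e "insert e \<kappa>"] that * by simp
    show ?thesis
    proof (cases "k + 1 \<ge> card \<kappa>")
      case True
      then have "(Suc k + 2 - card \<kappa>) div 2 = Suc ((k + 2 - Suc (card \<kappa>)) div 2)" by simp
      then show ?thesis
        using diff_vanish_additive_mult[OF _ fdg, of "\<lambda>x. x e"] False by (simp add: h_def)
    next
      \<comment> \<open>More odd coordinates than the degree allows: truncated subtraction gives
        order 0, so the coefficient is zero.\<close>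
      case False': False
      then have "(k + 2 - Suc (card \<kappa>)) div 2 = 0" by simp
      with fdg have "g e (insert e \<kappa>) x = 0" for x by simp
      then show ?thesis using False by (simp add: h_def diff_vanish_zero)
    qed
  qed
  have polyh: "polyfun (h e \<kappa>)" if "e \<in> E" "\<kappa> \<subseteq> E" for e \<kappa>
  proof (cases "e \<in> \<kappa>")
    case True
    then show ?thesis using g(2)[of e "\<kappa> - {e}"] that by (auto simp: h_def)
  next
    case False
    have "polyfun (g e (insert e \<kappa>))" using g(2) that by simp
    then show ?thesis using False unfolding h_def polyfun_def by (auto intro!: ispoly_mult)
  qed
  have step: "l e * G e l = (\<Sum>\<kappa>\<in>Pow E. (\<Prod>e\<in>\<kappa>. l e) * h e \<kappa> (\<lambda>e. (l e)^2))" if e: "e \<in> E" for e l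
  proof -
    let ?t = "\<lambda>\<kappa>. if e \<in> \<kappa> then \<kappa> - {e} else insert e \<kappa>"
    have "l e * G e l = (\<Sum>\<kappa>\<in>Pow E. l e * ((\<Prod>e\<in>\<kappa>. l e) * g e \<kappa> (\<lambda>e. (l e)^2)))"
      by (simp add: g(3)[OF e] sum_distrib_left)
    also have "\<dots> = (\<Sum>\<kappa>\<in>Pow E. (\<Prod>e\<in>\<kappa>. l e) * h e \<kappa> (\<lambda>e. (l e)^2))"
    proof (rule sum.reindex_bij_witness[of _ ?t ?t])
      fix \<kappa> assume "\<kappa> \<in> Pow E"
      then have fin: "finite \<kappa>" using assms finite_subset by auto
      show "(\<Prod>e\<in>?t \<kappa>. l e) * h e (?t \<kappa>) (\<lambda>e. (l e)^2) = l e * ((\<Prod>e\<in>\<kappa>. l e) * g e \<kappa> (\<lambda>e. (l e)^2))"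
      proof (cases "e \<in> \<kappa>")
        case True
        then have "(\<Prod>e\<in>\<kappa>. l e) = l e * (\<Prod>e\<in>\<kappa> - {e}. l e)"
          using fin by (simp add: prod.remove)
        then show ?thesis using True
          by (simp add: h_def insert_absorb power2_eq_square)
      next
        case False
        then show ?thesis using fin by (simp add: h_def)
      qed
    qed (use e in \<open>auto split: if_splits\<close>)
    finally show ?thesis .
  qed
  have "F l = (\<Sum>\<kappa>\<in>Pow E. (\<Prod>e\<in>\<kappa>. l e) * (\<lambda>x. \<Sum>e\<in>E. h e \<kappa> x) (\<lambda>e. (l e)^2))" for l
  proof -
    have "F l = (\<Sum>e\<in>E. \<Sum>\<kappa>\<in>Pow E. (\<Prod>e\<in>\<kappa>. l e) * h e \<kappa> (\<lambda>e. (l e)^2))"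
      by (simp add: G(2) step)
    also have "\<dots> = (\<Sum>\<kappa>\<in>Pow E. \<Sum>e\<in>E. (\<Prod>e\<in>\<kappa>. l e) * h e \<kappa> (\<lambda>e. (l e)^2))"
      by (rule sum.swap)
    finally show ?thesis by (simp add: sum_distrib_left)
  qed
  moreover have "diff_vanish ((Suc k + 2 - card \<kappa>) div 2) (\<lambda>x. \<Sum>e\<in>E. h e \<kappa> x)" if "\<kappa> \<subseteq> E" for \<kappa>
    using fdh that by (intro diff_vanish_sum)
  moreover have "polyfun (\<lambda>x. \<Sum>e\<in>E. h e \<kappa> x)" if "\<kappa> \<subseteq> E" for \<kappa>
    using polyh that unfolding polyfun_def by (auto intro!: ispoly_sum)
  ultimately show ?case by (intro exI[of _ "\<lambda>\<kappa> x. \<Sum>e\<in>E. h e \<kappa> x"]) blast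
qed

text \<open>Independence of the characters of the group of sign vectors. Fixing the sign at
  \<open>x\<close> as 1 and as -1 shows, by induction, that both the sum and the difference of
  \<open>a \<kappa>\<close> and \<open>a (insert x \<kappa>)\<close> vanish.\<close>

lemma sign_characters_independent:
  fixes a :: "'e set \<Rightarrow> complex"
  assumes "finite E"
    and "\<And>\<epsilon>. (\<And>e. \<epsilon> e \<in> {1, -1}) \<Longrightarrow> (\<Sum>\<kappa>\<in>Pow E. (\<Prod>e\<in>\<kappa>. \<epsilon> e) * a \<kappa>) = 0"
    and "\<kappa> \<subseteq> E"
  shows "a \<kappa> = 0"
  using assms
proof (induction E arbitrary: a \<kappa> rule: finite_induct)
  case empty
  then show ?case using empty.prems(1)[of "\<lambda>e. 1"] by simp
next
  case (insert x E)
  have split: "(\<Sum>\<kappa>\<in>Pow (insert x E). (\<Prod>e\<in>\<kappa>. \<epsilon> e) * a \<kappa>) =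
      (\<Sum>\<kappa>\<in>Pow E. (\<Prod>e\<in>\<kappa>. \<epsilon> e) * (a \<kappa> + \<epsilon> x * a (insert x \<kappa>)))" for \<epsilon>
  proof -
    have inj: "inj_on (insert x) (Pow E)" using insert.hyps(2) by (auto simp: inj_on_def)
    have "(\<Sum>\<kappa>\<in>Pow (insert x E). (\<Prod>e\<in>\<kappa>. \<epsilon> e) * a \<kappa>) =
      (\<Sum>\<kappa>\<in>Pow E. (\<Prod>e\<in>\<kappa>. \<epsilon> e) * a \<kappa>) + (\<Sum>\<kappa>\<in>insert x ` Pow E. (\<Prod>e\<in>\<kappa>. \<epsilon> e) * a \<kappa>)"
      unfolding Pow_insert using insert.hyps by (intro sum.union_disjoint) auto
    also have "(\<Sum>\<kappa>\<in>insert x ` Pow E. (\<Prod>e\<in>\<kappa>. \<epsilon> e) * a \<kappa>) =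
      (\<Sum>\<kappa>\<in>Pow E. (\<Prod>e\<in>insert x \<kappa>. \<epsilon> e) * a (insert x \<kappa>))"
      by (simp add: sum.reindex[OF inj])
    also have "\<dots> = (\<Sum>\<kappa>\<in>Pow E. (\<Prod>e\<in>\<kappa>. \<epsilon> e) * (\<epsilon> x * a (insert x \<kappa>)))"
    proof (rule sum.cong)
      fix \<kappa> assume "\<kappa> \<in> Pow E"
      then have "finite \<kappa>" "x \<notin> \<kappa>" using insert.hyps finite_subset by auto
      then show "(\<Prod>e\<in>insert x \<kappa>. \<epsilon> e) * a (insert x \<kappa>) = (\<Prod>e\<in>\<kappa>. \<epsilon> e) * (\<epsilon> x * a (insert x \<kappa>))"
        by simp
    qed simp
    finally show ?thesis by (simp add: sum.distrib distrib_left)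
  qed
  have *: "a \<kappa> + c * a (insert x \<kappa>) = 0" if c: "c \<in> {1, -1}" and \<kappa>: "\<kappa> \<subseteq> E" for c \<kappa>
  proof (rule insert.IH[of "\<lambda>\<kappa>. a \<kappa> + c * a (insert x \<kappa>)", OF _ \<kappa>])
    fix \<epsilon> :: "'e \<Rightarrow> complex" assume \<epsilon>: "\<And>e. \<epsilon> e \<in> {1, -1}"
    let ?\<epsilon> = "\<epsilon>(x := c)"
    have "(\<Sum>\<kappa>\<in>Pow E. (\<Prod>e\<in>\<kappa>. ?\<epsilon> e) * (a \<kappa> + ?\<epsilon> x * a (insert x \<kappa>))) = 0"
      unfolding split[symmetric] using \<epsilon> c by (intro insert.prems(1)) auto
    moreover have "(\<Prod>e\<in>\<kappa>. ?\<epsilon> e) = (\<Prod>e\<in>\<kappa>. \<epsilon> e)" if "\<kappa> \<in> Pow E" for \<kappa>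
      using that insert.hyps(2) by (intro prod.cong) auto
    ultimately show "(\<Sum>\<kappa>\<in>Pow E. (\<Prod>e\<in>\<kappa>. \<epsilon> e) * (a \<kappa> + c * a (insert x \<kappa>))) = 0"
      by simp
  qed
  have "a \<kappa> = 0 \<and> a (insert x \<kappa>) = 0" if "\<kappa> \<subseteq> E" for \<kappa>
    using *[of 1, OF _ that] *[of "-1", OF _ that] by (auto simp: add_eq_0_iff)
  moreover have "\<kappa> \<subseteq> E \<or> (\<exists>\<kappa>'\<subseteq>E. \<kappa> = insert x \<kappa>')"
    using insert.prems(2) by (metis subset_insert_iff insert_Diff)
  ultimately show ?case by blast
qed

section \<open>Polynomials vanishing on the variety are quadratic along stars\<close>

lemma diff_vanish_mono: "diff_vanish j f \<Longrightarrow> j \<le> k \<Longrightarrow> diff_vanish k f"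
proof (induction k)
  case (Suc k)
  then show ?case by (metis diff_vanish_Suc le_SucE)
qed simp

section \<open>Measurements of points on a line\<close>

lemma edgesE:
  assumes "e \<in> edges n"
  obtains i j where "e = (i, j)" "i < j" "j < n"
  using assms by (cases e) (auto simp: edges_def)

text \<open>The squared measurement of points \<open>u\<close> on a line. The elements of
  \<open>sq_meas_variety d n\<close> are the sums of \<open>d\<close> of these, one for each
  coordinate of the configuration.\<close>

definition sqd :: "nat \<Rightarrow> (nat \<Rightarrow> complex) \<Rightarrow> (nat \<times> nat \<Rightarrow> complex)" where
  "sqd n u = (\<lambda>(i, j). if (i, j) \<in> edges n then (u i - u j)^2 else 0)"

lemma finite_edges: "finite (edges n)"
  by (rule finite_subset[of _ "{..<n} \<times> {..<n}"]) (auto simp: edges_def)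

lemma sqd_in_vecs: "sqd n u \<in> vecs n"
  by (auto simp: sqd_def vecs_def)

lemma sqd_scale: "sqd n (\<lambda>i. c * u i) = (\<lambda>e. c^2 * sqd n u e)"
  by (auto simp: sqd_def fun_eq_iff power_mult_distrib simp flip: right_diff_distrib)

lemma ispoly_sqd:
  assumes "\<And>k. ispoly (\<lambda>s. u s k)"
  shows "ispoly (\<lambda>s. sqd n (u s) e)"
proof (cases "e \<in> edges n")
  case True
  then obtain i j where e: "e = (i, j)" by (rule edgesE)
  have "ispoly (\<lambda>s. (u s i - u s j)^2)"
    by (intro ispoly_power ispoly_diff assms)
  then show ?thesis using True by (simp add: sqd_def e)
next
  case False
  then show ?thesis by (cases e) (simp add: sqd_def ispoly_const)
qed

text \<open>Every complex scalar is a square and can be absorbed into the configuration.\<close>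

lemma sqd_cone: "(\<lambda>e. y * sqd n u e) \<in> range (sqd n)"
  using sqd_scale[of n "csqrt y" u] by (metis power2_csqrt rangeI)

lemma sum_list_sqd_in_variety:
  "set xs \<subseteq> range (sqd n) \<Longrightarrow> length xs \<le> d \<Longrightarrow> sum_list xs \<in> sq_meas_variety d n"
proof (induction d arbitrary: xs)
  case 0
  then show ?case by (auto simp: sq_meas_variety_def meas_def fun_eq_iff)
next
  case (Suc d)
  show ?case
  proof (cases xs)
    case Nil
    have "sum_list xs = meas (Suc d) n (\<lambda>i k. 0)"
      by (auto simp: Nil meas_def fun_eq_iff)
    then show ?thesis by (simp add: sq_meas_variety_def)
  next
    case (Cons x ys)
    then obtain u where u: "x = sqd n u" using Suc.prems by auto
    obtain p where p: "sum_list ys = meas d n p"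
      using Suc.IH[of ys] Suc.prems Cons by (auto simp: sq_meas_variety_def)
    have "sum_list xs = meas (Suc d) n (\<lambda>i k. if k = d then u i else p i k)"
      by (auto simp: Cons u p meas_def sqd_def fun_eq_iff)
    then show ?thesis by (simp add: sq_meas_variety_def)
  qed
qed

text \<open>Polarization: for the indicator functions of \<open>i\<close> and \<open>j\<close>, the
  measurements of both minus the measurement of their sum give twice the coordinate vector of the
  edge. Scalars are absorbed by \<open>sqd_cone\<close>, so plain sums suffice.\<close>

lemma sqd_spans:
  assumes "x \<in> vecs n"
  shows "\<exists>xs. set xs \<subseteq> range (sqd n) \<and> sum_list xs = x"
proof -
  let ?P = "\<lambda>x. \<exists>xs. set xs \<subseteq> range (sqd n) \<and> sum_list xs = x"
  have basis: "?P (\<lambda>f. if f = e then y else 0)" if "e \<in> edges n" for e y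
  proof -
    obtain i j where e: "e = (i, j)" "i < j" "j < n" using \<open>e \<in> edges n\<close> by (rule edgesE)
    let ?\<delta> = "\<lambda>i k. if k = i then 1 else (0::complex)"
    let ?xs = "[(\<lambda>e. y / 2 * sqd n (?\<delta> i) e), (\<lambda>e. y / 2 * sqd n (?\<delta> j) e),
        (\<lambda>e. - y / 2 * sqd n (\<lambda>k. ?\<delta> i k + ?\<delta> j k) e)]"
    have "set ?xs \<subseteq> range (sqd n)"
      unfolding list.set insert_subset by (intro conjI sqd_cone empty_subsetI)
    moreover have "sum_list ?xs = (\<lambda>f. if f = e then y else 0)"
      using e by (auto simp: fun_eq_iff sqd_def edges_def field_simps)
    ultimately show ?thesis by blast
  qed
  have "?P (\<lambda>f. \<Sum>e\<in>S. if f = e then x e else 0)" if "S \<subseteq> edges n" for S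
    using finite_subset[OF that finite_edges] that
  proof (induction S rule: finite_induct)
    case empty
    then show ?case by (intro exI[of _ "[]"]) (auto simp: fun_eq_iff)
  next
    case (insert e S)
    obtain xs where xs: "set xs \<subseteq> range (sqd n)" "sum_list xs = (\<lambda>f. \<Sum>e\<in>S. if f = e then x e else 0)"
      using insert by auto
    obtain ys where ys: "set ys \<subseteq> range (sqd n)" "sum_list ys = (\<lambda>f. if f = e then x e else 0)"
      using basis[of e "x e"] insert.prems by auto
    have "set (ys @ xs) \<subseteq> range (sqd n)" using xs ys by auto
    moreover have "sum_list (ys @ xs) = (\<lambda>f. \<Sum>e\<in>insert e S. if f = e then x e else 0)"
      using insert.hyps by (simp add: xs ys fun_eq_iff)
    ultimately show ?case by blast
  qed
  from this[of "edges n"] have "?P (\<lambda>f. \<Sum>e\<in>edges n. if f = e then x e else 0)" by simp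
  moreover have "(\<lambda>f. \<Sum>e\<in>edges n. if f = e then x e else 0) = x"
    using assms finite_edges[of n] by (auto simp: fun_eq_iff vecs_def)
  ultimately show ?thesis by simp
qed

text \<open>Sums of at most \<open>d\<close> one-dimensional measurements lie in the variety and
  arbitrary sums fill \<open>vecs n\<close>; a function of degree at most \<open>d\<close> is
  determined by the former.\<close>

lemma diff_vanish_vanish_on_vecs:
  assumes "diff_vanish k g" "k \<le> Suc d" "\<And>x. x \<in> sq_meas_variety d n \<Longrightarrow> g x = 0" "x \<in> vecs n"
  shows "g x = 0"
proof -
  obtain xs where xs: "set xs \<subseteq> range (sqd n)" "sum_list xs = x"
    using sqd_spans[OF assms(4)] by blast
  have "g (sum_list xs) = 0"
    by (rule diff_vanish_vanish_on_sums[OF diff_vanish_mono[OF assms(1,2)] _ xs(1)])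
      (auto intro!: assms(3) sum_list_sqd_in_variety)
  then show ?thesis using xs by simp
qed

text \<open>Sign changes preserve the unsquared variety, so the parity components of
  \<open>F\<close> vanish separately on the squared one. Those with an odd coordinate have degree at
  most \<open>d\<close> in the squares and vanish identically; only the even component
  remains.\<close>

lemma vanishing_even:
  assumes "d \<ge> 1" "hom_poly (edges n) (2 * d + 2) F" "\<And>l. l \<in> unsq_meas_variety d n \<Longrightarrow> F l = 0"
  obtains g where "diff_vanish (d + 2) g" "polyfun g" "\<And>x. x \<in> sq_meas_variety d n \<Longrightarrow> g x = 0"
    "\<And>l. l \<in> vecs n \<Longrightarrow> F l = g (\<lambda>e. (l e)^2)"
proof -
  let ?E = "edges n"
  obtain g where g0: "(\<forall>\<kappa>\<in>Pow ?E. diff_vanish ((2 * d + 4 - card \<kappa>) div 2) (g \<kappa>) \<and> polyfun (g \<kappa>)) \<and>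
    (\<forall>l. F l = (\<Sum>\<kappa>\<in>Pow ?E. (\<Prod>e\<in>\<kappa>. l e) * g \<kappa> (\<lambda>e. (l e)^2)))"
    using hom_poly_parity_decomposition[OF finite_edges assms(2)]
    unfolding add.assoc numeral_plus_numeral semiring_norm by (rule exE)
  have g: "\<And>\<kappa>. \<kappa> \<subseteq> ?E \<Longrightarrow> diff_vanish ((2 * d + 4 - card \<kappa>) div 2) (g \<kappa>)"
      "\<And>\<kappa>. \<kappa> \<subseteq> ?E \<Longrightarrow> polyfun (g \<kappa>)"
    and F: "\<And>l. F l = (\<Sum>\<kappa>\<in>Pow ?E. (\<Prod>e\<in>\<kappa>. l e) * g \<kappa> (\<lambda>e. (l e)^2))"
    using g0 by blast+
  \<comment> \<open>When no length is zero, the product of the odd coordinates can be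
    cancelled.\<close>
  have generic: "g \<kappa> (meas d n p) = 0" if \<kappa>: "\<kappa> \<subseteq> ?E" and nz: "\<And>e. e \<in> ?E \<Longrightarrow> meas d n p e \<noteq> 0" for \<kappa> p
  proof -
    let ?l = "\<lambda>e. csqrt (meas d n p e)"
    let ?a = "\<lambda>\<kappa>. (\<Prod>e\<in>\<kappa>. ?l e) * g \<kappa> (meas d n p)"
    have "?a \<kappa> = 0"
    proof (rule sign_characters_independent[OF finite_edges _ \<kappa>])
      fix \<epsilon> :: "nat \<times> nat \<Rightarrow> complex" assume \<epsilon>: "\<And>e. \<epsilon> e \<in> {1, -1}"
      have sq_len: "(\<lambda>e. (\<epsilon> e * ?l e)^2) = meas d n p"
      proof
        fix e show "(\<epsilon> e * ?l e)^2 = meas d n p e"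
          using \<epsilon>[of e] by (auto simp: power_mult_distrib)
      qed
      have "(\<lambda>e. \<epsilon> e * ?l e) \<in> unsq_meas_variety d n"
        unfolding unsq_meas_variety_def using sq_len
        by (auto simp: sq_meas_variety_def vecs_def meas_def)
      from assms(3)[OF this] show "(\<Sum>\<kappa>\<in>Pow ?E. (\<Prod>e\<in>\<kappa>. \<epsilon> e) * ?a \<kappa>) = 0"
        unfolding F sq_len by (simp add: prod.distrib mult.assoc)
    qed
    moreover have "(\<Prod>e\<in>\<kappa>. ?l e) \<noteq> 0"
      using nz \<kappa> finite_subset[OF \<kappa> finite_edges] by auto
    ultimately show ?thesis by simp
  qed
  have vanish: "g \<kappa> x = 0" if \<kappa>: "\<kappa> \<subseteq> ?E" and x: "x \<in> sq_meas_variety d n" for \<kappa> x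
  proof -
    obtain p where p: "x = meas d n p" using x by (auto simp: sq_meas_variety_def)
    \<comment> \<open>A curve of configurations from \<open>p\<close> at \<open>t = 0\<close> to
      distinct points on the first axis at \<open>t = 1\<close>, where no squared length vanishes.
      The generic case thus extends to \<open>t = 0\<close>.\<close>
    define \<gamma> where "\<gamma> t = meas d n (\<lambda>i k. p i k + t * ((if k = 0 then of_nat i else 0) - p i k))" for t
    have poly\<gamma>: "ispoly (\<lambda>t. \<gamma> t e)" for e
      by (cases e; cases "e \<in> ?E") (auto simp: \<gamma>_def meas_def intro!: ispoly_intros)
    have "g \<kappa> (\<gamma> 0) = 0"
    proof (rule ispoly_zero_product[where f = "\<lambda>t. g \<kappa> (\<gamma> t)"])
      show "ispoly (\<lambda>t. g \<kappa> (\<gamma> t))"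
        using polyfunD[OF g(2)[OF \<kappa>] poly\<gamma>] .
      show "ispoly (\<lambda>t. \<Prod>e\<in>?E. \<gamma> t e)"
        by (intro ispoly_prod poly\<gamma>)
      show "g \<kappa> (\<gamma> t) * (\<Prod>e\<in>?E. \<gamma> t e) = 0" for t
      proof (cases "\<exists>e\<in>?E. \<gamma> t e = 0")
        case True
        then show ?thesis using finite_edges by auto
      next
        case False
        then show ?thesis using generic[OF \<kappa>] unfolding \<gamma>_def by auto
      qed
      have "\<gamma> 1 e \<noteq> 0" if "e \<in> ?E" for e
      proof -
        obtain i j where e: "e = (i, j)" "i < j" "j < n" using \<open>e \<in> edges n\<close> by (rule edgesE)
        have "\<gamma> 1 e = (\<Sum>k<d. ((if k = 0 then of_nat i else 0) - (if k = 0 then of_nat j else 0))^2)"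
          using that e by (simp add: \<gamma>_def meas_def)
        also have "\<dots> = (\<Sum>k<d. (if k = 0 then (of_nat i - of_nat j)^2 else 0))"
          by (rule sum.cong) auto
        also have "\<dots> = (of_nat i - of_nat j)^2" using assms(1) by simp
        finally show ?thesis using e by simp
      qed
      then show "(\<Prod>e\<in>?E. \<gamma> 1 e) \<noteq> 0" using finite_edges by simp
    qed
    then show ?thesis by (simp add: \<gamma>_def p)
  qed
  have odd: "g \<kappa> x = 0" if "\<kappa> \<subseteq> ?E" "\<kappa> \<noteq> {}" "x \<in> vecs n" for \<kappa> x
  proof (rule diff_vanish_vanish_on_vecs[OF g(1)[OF that(1)] _ vanish[OF that(1)] that(3)])
    \<comment> \<open>One odd coordinate already lowers the order from \<open>d + 2\<close> to
      \<open>d + 1\<close>, the largest that \<open>diff_vanish_vanish_on_vecs\<close>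
      admits.\<close>
    have "card \<kappa> > 0" using that finite_subset[OF that(1) finite_edges] by (simp add: card_gt_0_iff)
    then show "(2 * d + 4 - card \<kappa>) div 2 \<le> Suc d" by linarith
  qed
  have "F l = g {} (\<lambda>e. (l e)^2)" if "l \<in> vecs n" for l
  proof -
    have "F l = (\<Sum>\<kappa>\<in>Pow ?E. if \<kappa> = {} then g {} (\<lambda>e. (l e)^2) else 0)"
      unfolding F using odd that by (intro sum.cong) (auto simp: vecs_def)
    then show ?thesis using finite_edges[of n] by simp
  qed
  moreover have "diff_vanish (d + 2) (g {})" using g(1)[of "{}"] by (simp del: diff_vanish.simps)
  ultimately show thesis using that[of "g {}"] g(2)[of "{}"] vanish[of "{}"] by simp
qed

text \<open>Measurements \<open>sqd n u\<close> correspond to matrices of rank one, and for the \<open>(d + 1)\<close>-minors the claim is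
  visible.\<close>

lemma affine_along_sqd:
  assumes "d \<ge> 1" "diff_vanish (d + 2) g" "polyfun g" "\<And>x. x \<in> sq_meas_variety d n \<Longrightarrow> g x = 0" "x \<in> vecs n"
  shows "g (\<lambda>e. x e + y * sqd n u e) = g x + y * (g (\<lambda>e. x e + sqd n u e) - g x)"
proof -
  define D where "D a = (\<lambda>e. a * sqd n u e)" for a
  have D: "D a \<in> range (sqd n)" "D a + D b = D (a + b)" for a b
    using sqd_cone by (auto simp: D_def fun_eq_iff distrib_right)
  obtain xs where xs: "set xs \<subseteq> range (sqd n)" "sum_list xs = x"
    using sqd_spans[OF assms(5)] by blast
  have zero: "(g (x + D b + D a) - g (x + D b)) - (g (x + D a) - g x) = 0" for a b
  proof -
    \<comment> \<open>Two differences lower the order to \<open>d\<close>, so only sums of fewer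
      than \<open>d\<close> measurements must be tested. Adding both directions to such a sum costs
      just one more measurement, because \<open>D a + D b = D (a + b)\<close>.\<close>
    have "diff_vanish d (\<lambda>x. (g (x + D b + D a) - g (x + D b)) - (g (x + D a) - g x))"
      using assms(2) diff_vanish_SucD[OF diff_vanish_SucD[of "Suc d" g "D a"], of "D b"] by (simp del: diff_vanish.simps)
    then have "(g (sum_list xs + D b + D a) - g (sum_list xs + D b)) - (g (sum_list xs + D a) - g (sum_list xs)) = 0"
    proof (rule diff_vanish_vanish_on_sums[OF _ _ xs(1)])
      fix zs assume zs: "set zs \<subseteq> range (sqd n)" "length zs < d"
      have g0: "g (sum_list zs + D c) = 0" for c
      proof -
        have "sum_list (D c # zs) \<in> sq_meas_variety d n"
          using zs D(1)[of c] by (intro sum_list_sqd_in_variety) auto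
        then show ?thesis using assms(4) by (simp add: add.commute)
      qed
      have "D 0 = 0" by (auto simp: D_def fun_eq_iff)
      then have "g (sum_list zs) = 0" using g0[of 0] by simp
      then show "(g (sum_list zs + D b + D a) - g (sum_list zs + D b)) - (g (sum_list zs + D a) - g (sum_list zs)) = 0"
        by (simp add: add.assoc D(2) g0)
    qed
    then show ?thesis by (simp add: xs)
  qed
  let ?f = "\<lambda>y. g (\<lambda>e. x e + y * sqd n u e)"
  have f: "?f y = g (x + D y)" for y
    by (rule arg_cong[of _ _ g]) (auto simp: D_def)
  have "?f y = ?f 0 + y * (?f 1 - ?f 0)"
  proof (rule ispoly_additive_linear)
    show "ispoly ?f"
      by (rule polyfunD[OF assms(3)]) (intro ispoly_intros)
    fix a b
    have "D 0 = 0" by (auto simp: D_def fun_eq_iff)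
    moreover have "(g (x + D (a + b)) - g (x + D b)) - (g (x + D a) - g x) = 0"
      using zero[of b a] D(2)[of b a] by (simp add: add.assoc add.commute[of b a])
    ultimately show "?f (a + b) - ?f a - ?f b + ?f 0 = 0"
      unfolding f by (simp add: algebra_simps)
  qed
  then show ?thesis by simp
qed

definition edge :: "nat \<Rightarrow> nat \<Rightarrow> nat \<times> nat" where
  "edge i j = (min i j, max i j)"

definition star :: "nat \<Rightarrow> nat \<Rightarrow> (nat \<times> nat \<Rightarrow> complex) \<Rightarrow> bool" where
  "star n z v \<longleftrightarrow> v \<in> vecs n \<and> z < n \<and> (\<exists>c. c \<noteq> 0 \<and> (\<forall>j<n. j \<noteq> z \<longrightarrow> (v (edge z j))^2 = c)) \<and>
    (\<forall>i j. i \<noteq> z \<longrightarrow> j \<noteq> z \<longrightarrow> v (i, j) = 0)"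

lemma edge_commute: "edge i j = edge j i"
  by (simp add: edge_def min.commute max.commute)

text \<open>Completing the square: let \<open>\<gamma>^2\<close> be the common square of the star
  and \<open>\<gamma> * b k\<close> the product of \<open>w\<close> and \<open>v\<close> on the edge
  from \<open>z\<close> to \<open>k\<close>. Up to a term free of \<open>s\<close>, the squared
  length there is \<open>(s * \<gamma> + b k)^2\<close>, the squared distance of points at
  \<open>s * \<gamma>\<close> and \<open>- b k\<close>. Edges away from \<open>z\<close> do not
  change with \<open>s\<close>.\<close>

lemma star_line:
  assumes st: "star n z v" and w: "w \<in> vecs n"
  obtains x \<gamma> b where "x \<in> vecs n"
    "\<And>s. (\<lambda>e. (w e + s * v e)^2) = (\<lambda>e. x e + sqd n (\<lambda>k. s * (if k = z then \<gamma> else 0) - b k) e)"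
proof -
  obtain c where c: "c \<noteq> 0" "\<And>j. j < n \<Longrightarrow> j \<noteq> z \<Longrightarrow> (v (edge z j))^2 = c"
    using st unfolding star_def by metis
  define \<gamma> where "\<gamma> = csqrt c"
  have \<gamma>: "\<gamma>^2 = c" "\<gamma> \<noteq> 0" using c(1) by (auto simp: \<gamma>_def)
  define b where "b k = (if k = z then 0 else w (edge z k) * v (edge z k) / \<gamma>)" for k
  define x where "x = (\<lambda>e. (w e)^2 - sqd n b e)"
  have b: "\<gamma> * b k = w (edge z k) * v (edge z k)" "(b k)^2 = (w (edge z k))^2" if "k < n" "k \<noteq> z" for k
    using c(2)[OF that] \<gamma> c(1) that by (auto simp: b_def power_divide power_mult_distrib)
  have "x \<in> vecs n" using w by (auto simp: x_def vecs_def sqd_def)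
  moreover have "(w e + s * v e)^2 = x e + sqd n (\<lambda>k. s * (if k = z then \<gamma> else 0) - b k) e" for s e
  proof (cases "e \<in> edges n")
    case False
    then show ?thesis using w st by (cases e) (auto simp: star_def vecs_def x_def sqd_def)
  next
    case True
    obtain i j where e: "e = (i, j)" "i < j" "j < n" using True by (rule edgesE)
    have spoke: "(w (edge z k) + s * v (edge z k))^2 = (w (edge z k))^2 - (b k)^2 + (s * \<gamma> + b k)^2"
      if k: "k < n" "k \<noteq> z" for k
    proof -
      have "(w (edge z k) + s * v (edge z k))^2 = (w (edge z k))^2 + 2 * s * (w (edge z k) * v (edge z k)) + s^2 * (v (edge z k))^2"
        by (simp add: power2_eq_square algebra_simps)
      also have "\<dots> = (w (edge z k))^2 + 2 * s * (\<gamma> * b k) + s^2 * \<gamma>^2"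
        using b[OF k] c(2)[OF k] \<gamma> by simp
      also have "\<dots> = (w (edge z k))^2 - (b k)^2 + (s * \<gamma> + b k)^2"
        by (simp add: power2_eq_square algebra_simps)
      finally show ?thesis .
    qed
    have bz: "b z = 0" by (simp add: b_def)
    consider "i = z" | "j = z" | "i \<noteq> z" "j \<noteq> z" by blast
    then show ?thesis
    proof cases
      case 1
      then have "edge z j = e" "j \<noteq> z" using e by (auto simp: edge_def)
      then show ?thesis using spoke[of j] e True 1 bz by (simp add: x_def sqd_def)
    next
      case 2
      then have "edge z i = e" "i \<noteq> z" "i < n" using e by (auto simp: edge_def)
      moreover have "(- b i - s * \<gamma>)^2 = (s * \<gamma> + b i)^2"
        by (simp add: power2_eq_square algebra_simps)
      ultimately show ?thesis using spoke[of i] e True 2 bz by (simp add: x_def sqd_def)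
    next
      case 3
      then have "v e = 0" using st e by (simp add: star_def)
      moreover have "(b j - b i)^2 = (b i - b j)^2" by (rule power2_commute)
      ultimately show ?thesis using e True 3 by (simp add: x_def sqd_def)
    qed
  qed
  ultimately show thesis using that by blast
qed

text \<open>Since \<open>sqd\<close> is quadratic, the measurement in \<open>star_line\<close> is
  \<open>s^2\<close> times one that depends on \<open>1 / s\<close>. Affinity of \<open>g\<close>
  along measurements moves the factor \<open>s^2\<close> out of \<open>g\<close>, which is the
  situation of \<open>deg_le_2_reversal\<close>.\<close>

theorem star_deg_le_2:
  assumes d: "d \<ge> 1" and F: "hom_poly (edges n) (2 * d + 2) F" "\<And>l. l \<in> unsq_meas_variety d n \<Longrightarrow> F l = 0"
    and st: "star n z v" and w: "w \<in> vecs n"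
  shows "deg_le 2 (\<lambda>s. F (\<lambda>e. w e + s * v e))"
proof -
  obtain g where g: "diff_vanish (d + 2) g" "polyfun g" "\<And>x. x \<in> sq_meas_variety d n \<Longrightarrow> g x = 0"
    "\<And>l. l \<in> vecs n \<Longrightarrow> F l = g (\<lambda>e. (l e)^2)"
    using vanishing_even[OF d F] by blast
  obtain x \<gamma> b where x: "x \<in> vecs n" and line:
    "\<And>s. (\<lambda>e. (w e + s * v e)^2) = (\<lambda>e. x e + sqd n (\<lambda>k. s * (if k = z then \<gamma> else 0) - b k) e)"
    by (rule star_line[OF st w]) blast
  have Fg: "F (\<lambda>e. w e + s * v e) = g (\<lambda>e. x e + sqd n (\<lambda>k. s * (if k = z then \<gamma> else 0) - b k) e)" for s
  proof -
    have "(\<lambda>e. w e + s * v e) \<in> vecs n" using w st by (auto simp: vecs_def star_def)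
    then show ?thesis using g(4) line by simp
  qed
  let ?f = "\<lambda>s. g (\<lambda>e. x e + sqd n (\<lambda>k. s * (if k = z then \<gamma> else 0) - b k) e) - g x"
  let ?h = "\<lambda>t. g (\<lambda>e. x e + sqd n (\<lambda>k. (if k = z then \<gamma> else 0) - t * b k) e) - g x"
  have "deg_le 2 ?f"
  proof (rule deg_le_2_reversal)
    have "ispoly (\<lambda>s. x e + sqd n (\<lambda>k. s * (if k = z then \<gamma> else 0) - b k) e)"
         "ispoly (\<lambda>t. x e + sqd n (\<lambda>k. (if k = z then \<gamma> else 0) - t * b k) e)" for e
      by (intro ispoly_add ispoly_const ispoly_sqd ispoly_diff ispoly_mult ispoly_id)+
    note p = polyfunD[OF g(2) this(1)] polyfunD[OF g(2) this(2)]
    show "ispoly ?f" "ispoly ?h"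
      by (rule ispoly_diff[OF p(1) ispoly_const], rule ispoly_diff[OF p(2) ispoly_const])
    fix s :: complex assume s: "s \<noteq> 0"
    have "(\<lambda>k. s * (if k = z then \<gamma> else 0) - b k) = (\<lambda>k. s * ((if k = z then \<gamma> else 0) - 1 / s * b k))"
      using s by (auto simp: fun_eq_iff field_simps)
    then have "?f s = g (\<lambda>e. x e + s^2 * sqd n (\<lambda>k. (if k = z then \<gamma> else 0) - 1 / s * b k) e) - g x"
      by (simp only: sqd_scale)
    also have "\<dots> = s^2 * ?h (1 / s)"
      by (subst affine_along_sqd[OF d g(1,2,3) x]) simp_all
    finally show "?f s = s^2 * ?h (1 / s)" .
  qed
  moreover have "deg_le 2 (\<lambda>s. g x)" unfolding deg_le_def by (intro exI[of _ "[:g x:]"]) simp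
  ultimately have "deg_le 2 (\<lambda>s. ?f s + g x)" by (rule deg_le_add)
  then show ?thesis by (simp add: Fg)
qed

section \<open>Cayley--Menger determinants\<close>

text \<open>The determinant by the Leibniz formula, over an arbitrary index set so that vertices can
  serve as rows and columns without renumbering.\<close>

definition set_det :: "'a set \<Rightarrow> ('a \<Rightarrow> 'a \<Rightarrow> complex) \<Rightarrow> complex" where
  "set_det U M = (\<Sum>\<pi> | \<pi> permutes U. of_int (sign \<pi>) * (\<Prod>i\<in>U. M i (\<pi> i)))"

lemma set_det_cong:
  assumes "\<And>i j. i \<in> U \<Longrightarrow> j \<in> U \<Longrightarrow> M i j = N i j"
  shows "set_det U M = set_det U N"
  unfolding set_det_def using assms permutes_in_image by (intro sum.cong) (fastforce intro!: prod.cong)+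

lemma sign_comp_transpose:
  assumes "finite U" "\<pi> permutes U" "a \<noteq> b"
  shows "sign (\<pi> \<circ> Transposition.transpose a b) = - sign \<pi>"
proof -
  have "permutation (Transposition.transpose a b)"
    by (rule permutes_imp_permutation[of "{a, b}"]) (auto intro: permutes_swap_id)
  then show ?thesis
    using permutes_imp_permutation[OF assms(1,2)] assms(3) by (simp add: sign_compose sign_swap_id)
qed

text \<open>Expanding the products assigns an inner index below \<open>d\<close> to every row. Two
  rows must share theirs, and transposing these rows cancels the permutations in pairs.\<close>

lemma set_det_low_rank:
  assumes U: "finite U" and d: "d < card U"
    and M: "\<And>i j. i \<in> U \<Longrightarrow> j \<in> U \<Longrightarrow> M i j = (\<Sum>k<d. x i k * y j k)"
  shows "set_det U M = 0"
proof -
  let ?P = "{\<pi>. \<pi> permutes U}"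
  let ?K = "PiE U (\<lambda>_. {..<d})"
  define t where "t \<kappa> \<pi> = of_int (sign \<pi>) * (\<Prod>i\<in>U. x i (\<kappa> i) * y (\<pi> i) (\<kappa> i))" for \<kappa> \<pi>
  have "set_det U M = (\<Sum>\<pi>\<in>?P. \<Sum>\<kappa>\<in>?K. t \<kappa> \<pi>)"
    unfolding set_det_def
  proof (rule sum.cong)
    fix \<pi> assume \<pi>: "\<pi> \<in> ?P"
    have "(\<Prod>i\<in>U. M i (\<pi> i)) = (\<Prod>i\<in>U. \<Sum>k<d. x i k * y (\<pi> i) k)"
      using \<pi> by (intro prod.cong M) (auto simp: permutes_in_image)
    also have "\<dots> = (\<Sum>\<kappa>\<in>?K. \<Prod>i\<in>U. x i (\<kappa> i) * y (\<pi> i) (\<kappa> i))"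
      using U by (subst prod_sum_PiE) auto
    finally show "of_int (sign \<pi>) * (\<Prod>i\<in>U. M i (\<pi> i)) = (\<Sum>\<kappa>\<in>?K. t \<kappa> \<pi>)"
      by (simp add: t_def sum_distrib_left)
  qed simp
  also have "\<dots> = (\<Sum>\<kappa>\<in>?K. \<Sum>\<pi>\<in>?P. t \<kappa> \<pi>)" by (rule sum.swap)
  also have "\<dots> = 0"
  proof (rule sum.neutral, rule ballI)
    fix \<kappa> assume \<kappa>: "\<kappa> \<in> ?K"
    have "\<not> inj_on \<kappa> U"
    proof
      assume "inj_on \<kappa> U"
      moreover have "\<kappa> ` U \<subseteq> {..<d}" using \<kappa> by auto
      ultimately have "card U \<le> d" using card_inj_on_le[of \<kappa> U "{..<d}"] by simp
      with d show False by simp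
    qed
    then obtain a b where ab: "a \<in> U" "b \<in> U" "a \<noteq> b" "\<kappa> a = \<kappa> b" by (auto simp: inj_on_def)
    have tr: "Transposition.transpose a b permutes U" using ab by (simp add: permutes_swap_id)
    have "t \<kappa> (\<pi> \<circ> Transposition.transpose a b) = - t \<kappa> \<pi>" if "\<pi> \<in> ?P" for \<pi>
    proof -
      have "(\<Prod>i\<in>U. y ((\<pi> \<circ> Transposition.transpose a b) i) (\<kappa> i)) = (\<Prod>i\<in>U. y (\<pi> i) (\<kappa> (Transposition.transpose a b i)))"
        by (rule prod.reindex_bij_witness[of _ "Transposition.transpose a b" "Transposition.transpose a b"])
          (use tr in \<open>auto simp: permutes_in_image\<close>)
      also have "\<dots> = (\<Prod>i\<in>U. y (\<pi> i) (\<kappa> i))"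
        using ab by (intro prod.cong) (auto simp: Transposition.transpose_def)
      finally show ?thesis
        using sign_comp_transpose[OF U, of \<pi> a b] that ab by (simp add: t_def prod.distrib)
    qed
    then have "(\<Sum>\<pi>\<in>?P. t \<kappa> \<pi>) = (\<Sum>\<pi>\<in>?P. - t \<kappa> \<pi>)"
      by (intro sum.reindex_bij_witness[of _ "\<lambda>\<pi>. \<pi> \<circ> Transposition.transpose a b" "\<lambda>\<pi>. \<pi> \<circ> Transposition.transpose a b"])
        (use tr in \<open>auto simp: permutes_compose comp_assoc\<close>)
    then show "(\<Sum>\<pi>\<in>?P. t \<kappa> \<pi>) = 0" by (simp add: sum_negf)
  qed
  finally show ?thesis .
qed

text \<open>Only permutations that exchange \<open>a\<close> and \<open>b\<close> pick up
  \<open>y\<close> twice. They are the permutations of \<open>U\<close> composed with a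
  transposition, which accounts for the minus sign.\<close>

lemma set_det_insert_pair:
  assumes U: "finite U" and ab: "a \<notin> U" "b \<notin> U" "a \<noteq> b"
  shows "\<exists>\<beta> \<gamma>. \<forall>y. set_det (insert a (insert b U)) (\<lambda>i j. if (i, j) = (a, b) \<or> (i, j) = (b, a) then y else M i j)
    = - (y^2) * set_det U M + \<beta> * y + \<gamma>"
proof -
  let ?V = "insert a (insert b U)"
  let ?N = "\<lambda>y i j. if (i, j) = (a, b) \<or> (i, j) = (b, a) then y else M i j"
  let ?P = "{\<pi>. \<pi> permutes ?V}"
  let ?Q = "{\<pi>. \<pi> permutes ?V \<and> \<pi> a = b \<and> \<pi> b = a}"
  let ?tr = "Transposition.transpose a b"
  define t where "t y \<pi> = of_int (sign \<pi>) * (\<Prod>i\<in>?V. ?N y i (\<pi> i))" for y \<pi>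
  have tr: "?tr permutes ?V" by (simp add: permutes_swap_id)
  have finP: "finite ?P" using U by (intro finite_permutations) simp
  have t: "t y \<pi> = of_int (sign \<pi>) * (?N y a (\<pi> a) * ?N y b (\<pi> b) * (\<Prod>i\<in>U. M i (\<pi> i)))" for y \<pi>
  proof -
    have "(\<Prod>i\<in>U. ?N y i (\<pi> i)) = (\<Prod>i\<in>U. M i (\<pi> i))"
      using ab by (intro prod.cong) auto
    then show ?thesis unfolding t_def using U ab by simp
  qed
  have Q: "(\<Sum>\<pi>\<in>?Q. t y \<pi>) = - (y^2) * set_det U M" for y
  proof -
    have "(\<Sum>\<pi>\<in>?Q. t y \<pi>) = (\<Sum>\<pi> | \<pi> permutes U. - (y^2) * (of_int (sign \<pi>) * (\<Prod>i\<in>U. M i (\<pi> i))))"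
    proof (rule sum.reindex_bij_witness[of _ "\<lambda>\<pi>. \<pi> \<circ> ?tr" "\<lambda>\<pi>. \<pi> \<circ> ?tr"])
      fix \<pi> assume \<pi>: "\<pi> \<in> ?Q"
      show "\<pi> \<circ> ?tr \<circ> ?tr = \<pi>" by (simp add: comp_assoc)
      show "\<pi> \<circ> ?tr \<in> {\<pi>. \<pi> permutes U}"
        using \<pi> by (intro CollectI permutes_superset[OF permutes_compose[OF tr, of \<pi>]]) auto
      have "(\<Prod>i\<in>U. M i ((\<pi> \<circ> ?tr) i)) = (\<Prod>i\<in>U. M i (\<pi> i))"
        using ab by (intro prod.cong) (auto simp: Transposition.transpose_def)
      moreover have "sign (\<pi> \<circ> ?tr) = - sign \<pi>"
        using \<pi> U ab by (intro sign_comp_transpose[of ?V]) auto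
      ultimately show "- (y^2) * (of_int (sign (\<pi> \<circ> ?tr)) * (\<Prod>i\<in>U. M i ((\<pi> \<circ> ?tr) i))) = t y \<pi>"
        using \<pi> by (simp add: t power2_eq_square)
    next
      fix \<pi> assume "\<pi> \<in> {\<pi>. \<pi> permutes U}"
      then have \<pi>: "\<pi> permutes U" by simp
      show "\<pi> \<circ> ?tr \<circ> ?tr = \<pi>" by (simp add: comp_assoc)
      have "\<pi> permutes ?V" by (rule permutes_subset[OF \<pi>]) auto
      then show "\<pi> \<circ> ?tr \<in> ?Q"
        using tr ab permutes_not_in[OF \<pi>] by (auto simp: permutes_compose)
    qed
    then show ?thesis by (simp add: set_det_def sum_distrib_left)
  qed
  have "\<exists>c0 c1. \<forall>y. t y \<pi> = c0 + c1 * y" if \<pi>: "\<pi> \<in> ?P - ?Q" for \<pi>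
  proof -
    let ?r = "of_int (sign \<pi>) * (\<Prod>i\<in>U. M i (\<pi> i))"
    consider "\<pi> a \<noteq> b" "\<pi> b \<noteq> a" | "\<pi> a = b" "\<pi> b \<noteq> a" | "\<pi> a \<noteq> b" "\<pi> b = a"
      using \<pi> by auto
    then show ?thesis
    proof cases
      case 1
      then show ?thesis using ab
        by (intro exI[of _ "?r * M a (\<pi> a) * M b (\<pi> b)"] exI[of _ 0]) (auto simp: t)
    next
      case 2
      then show ?thesis using ab
        by (intro exI[of _ 0] exI[of _ "?r * M b (\<pi> b)"]) (auto simp: t)
    next
      case 3
      then show ?thesis using ab
        by (intro exI[of _ 0] exI[of _ "?r * M a (\<pi> a)"]) (auto simp: t)
    qed
  qed
  then have "\<forall>\<pi>\<in>?P - ?Q. \<exists>c0 c1. \<forall>y. t y \<pi> = c0 + c1 * y" by blast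
  from bchoice[OF this] obtain c0 where "\<forall>\<pi>\<in>?P - ?Q. \<exists>c1. \<forall>y. t y \<pi> = c0 \<pi> + c1 * y" ..
  from bchoice[OF this] obtain c1 where "\<forall>\<pi>\<in>?P - ?Q. \<forall>y. t y \<pi> = c0 \<pi> + c1 \<pi> * y" ..
  then have c: "\<And>\<pi> y. \<pi> \<in> ?P - ?Q \<Longrightarrow> t y \<pi> = c0 \<pi> + c1 \<pi> * y" by blast
  have "set_det ?V (?N y) = - (y^2) * set_det U M + (\<Sum>\<pi>\<in>?P - ?Q. c1 \<pi>) * y + (\<Sum>\<pi>\<in>?P - ?Q. c0 \<pi>)" for y
  proof -
    have "set_det ?V (?N y) = (\<Sum>\<pi>\<in>?P. t y \<pi>)" by (simp add: set_det_def t_def)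
    also have "\<dots> = (\<Sum>\<pi>\<in>?P - ?Q. t y \<pi>) + (\<Sum>\<pi>\<in>?Q. t y \<pi>)"
      using finP by (intro sum.subset_diff) auto
    also have "(\<Sum>\<pi>\<in>?P - ?Q. t y \<pi>) = (\<Sum>\<pi>\<in>?P - ?Q. c0 \<pi> + c1 \<pi> * y)"
      by (intro sum.cong c) auto
    finally show ?thesis by (simp add: Q sum.distrib sum_distrib_right)
  qed
  then show ?thesis by blast
qed

section \<open>Determinants as polynomials in the edge lengths\<close>

definition sq_len :: "(nat \<times> nat \<Rightarrow> complex) \<Rightarrow> nat \<Rightarrow> nat \<Rightarrow> complex" where
  "sq_len l i j = (if i = j then 0 else (l (edge i j))^2)"

text \<open>For squared lengths \<open>|p\<^sub>i - p\<^sub>j|\<^sup>2\<close> this is twice the inner product of \<open>p\<^sub>i - p\<^sub>x\<close> and \<open>p\<^sub>j - p\<^sub>x\<close>.\<close>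

definition gram :: "(nat \<times> nat \<Rightarrow> complex) \<Rightarrow> nat \<Rightarrow> nat \<Rightarrow> nat \<Rightarrow> complex" where
  "gram l x i j = sq_len l x i + sq_len l x j - sq_len l i j"

text \<open>For \<open>x \<notin> U\<close> this is, up to sign, the bordered Cayley--Menger
  determinant of \<open>insert x U\<close>.\<close>

definition cayley_menger :: "nat \<Rightarrow> nat set \<Rightarrow> (nat \<times> nat \<Rightarrow> complex) \<Rightarrow> complex" where
  "cayley_menger x U l = set_det U (gram l x)"

lemma edge_eq_iff: "edge i j = edge k m \<longleftrightarrow> i = k \<and> j = m \<or> i = m \<and> j = k"
  by (auto simp: edge_def min_def max_def)

lemma edge_in_edges: "i < n \<Longrightarrow> j < n \<Longrightarrow> i \<noteq> j \<Longrightarrow> edge i j \<in> edges n"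
  by (auto simp: edge_def edges_def min_def max_def)

lemma sq_len_commute: "sq_len l i j = sq_len l j i"
  by (simp add: sq_len_def edge_commute)

lemma sq_len_variety:
  assumes "l \<in> unsq_meas_variety d n"
  shows "\<exists>p. \<forall>i<n. \<forall>j<n. sq_len l i j = (\<Sum>k<d. (p i k - p j k)^2)"
proof -
  obtain p where p: "(\<lambda>e. (l e)^2) = meas d n p"
    using assms by (auto simp: unsq_meas_variety_def sq_meas_variety_def)
  have "sq_len l i j = (\<Sum>k<d. (p i k - p j k)^2)" if "i < n" "j < n" for i j
  proof (cases "i = j")
    case False
    have "sq_len l i j = meas d n p (edge i j)"
      using False fun_cong[OF p, of "edge i j"] by (simp add: sq_len_def)
    also have "\<dots> = (\<Sum>k<d. (p i k - p j k)^2)"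
      using edge_in_edges[OF that False]
      by (auto simp: meas_def edge_def min_def max_def power2_commute intro!: sum.cong split: if_splits)
    finally show ?thesis .
  qed (simp add: sq_len_def)
  then show ?thesis by blast
qed

text \<open>On the variety \<open>gram\<close> is twice a matrix of inner products in dimension
  \<open>d\<close>, so its rank is at most \<open>d\<close>.\<close>

lemma cayley_menger_vanish:
  assumes "l \<in> unsq_meas_variety d n" "x < n" "U \<subseteq> {..<n}" "d < card U"
  shows "cayley_menger x U l = 0"
proof -
  obtain p where p: "\<forall>i<n. \<forall>j<n. sq_len l i j = (\<Sum>k<d. (p i k - p j k)^2)"
    using sq_len_variety[OF assms(1)] ..
  show ?thesis unfolding cayley_menger_def
  proof (rule set_det_low_rank[OF _ assms(4)])
    show "finite U" using assms(3) finite_subset by blast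
    fix i j assume "i \<in> U" "j \<in> U"
    then have "i < n" "j < n" using assms(3) by auto
    then show "gram l x i j = (\<Sum>k<d. 2 * (p i k - p x k) * (p j k - p x k))"
      using assms(2) unfolding gram_def
      by (simp add: p flip: sum.distrib sum_subtractf) (auto intro!: sum.cong simp: power2_eq_square algebra_simps)
  qed
qed

lemma hom_poly_sq_len: "i < n \<Longrightarrow> j < n \<Longrightarrow> hom_poly (edges n) 2 (\<lambda>l. sq_len l i j)"
proof (cases "i = j")
  case False
  assume "i < n" "j < n"
  then have "edge i j \<in> edges n" using False by (rule edge_in_edges)
  then have c: "hom_poly (edges n) (Suc 0) (\<lambda>l. l (edge i j))" by (rule hom_poly_coord[OF finite_edges])
  show ?thesis using hom_poly_mult[OF c c] False by (simp add: sq_len_def power2_eq_square numeral_2_eq_2 del: hom_poly.simps)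
qed (auto simp: sq_len_def intro: hom_poly_zero)

lemma hom_poly_cayley_menger:
  assumes "x < n" "U \<subseteq> {..<n}"
  shows "hom_poly (edges n) (2 * card U) (cayley_menger x U)"
proof -
  have fin: "finite U" using assms finite_subset by blast
  have "hom_poly (edges n) (2 * card U) (\<lambda>l. \<Sum>\<pi> | \<pi> permutes U. of_int (sign \<pi>) * (\<Prod>i\<in>U. gram l x i (\<pi> i)))"
  proof (intro hom_poly_sum hom_poly_cmult hom_poly_prod fin)
    fix \<pi> i assume "\<pi> \<in> {\<pi>. \<pi> permutes U}" and i: "i \<in> U"
    then have "\<pi> i \<in> U" by (simp add: permutes_in_image)
    with i show "hom_poly (edges n) 2 (\<lambda>l. gram l x i (\<pi> i))"
      unfolding gram_def using assms by (intro hom_poly_diff hom_poly_add hom_poly_sq_len) auto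
  qed
  then show ?thesis by (simp add: cayley_menger_def[abs_def] set_det_def)
qed

text \<open>As \<open>x\<close> is neither \<open>a\<close> nor \<open>b\<close>, the length of the
  edge \<open>ab\<close> enters only the two symmetric entries of the Gram matrix for
  \<open>a\<close> and \<open>b\<close>, each of the form \<open>\<eta> - y^2\<close>.\<close>

lemma cayley_menger_pair:
  assumes "finite U" "a \<notin> U" "b \<notin> U" "a \<noteq> b" "x \<notin> U" "x \<noteq> a" "x \<noteq> b"
  shows "\<exists>\<beta> \<gamma> \<eta>. \<forall>y. cayley_menger x (insert a (insert b U)) (l(edge a b := y)) =
    - ((\<eta> - y^2)^2) * cayley_menger x U l + \<beta> * (\<eta> - y^2) + \<gamma>"
proof -
  let ?V = "insert a (insert b U)"
  define \<eta> where "\<eta> = sq_len l x a + sq_len l x b"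
  have sq_len: "sq_len (l(edge a b := y)) i j = (if (i, j) = (a, b) \<or> (i, j) = (b, a) then y^2 else sq_len l i j)" for i j y
    using assms(4) by (auto simp: sq_len_def edge_eq_iff)
  have gram: "gram (l(edge a b := y)) x i j = (if (i, j) = (a, b) \<or> (i, j) = (b, a) then \<eta> - y^2 else gram l x i j)"
    for i j y
    using assms(6,7) by (auto simp: gram_def sq_len \<eta>_def)
  have "\<exists>\<beta> \<gamma>. \<forall>y. set_det ?V (\<lambda>i j. if (i, j) = (a, b) \<or> (i, j) = (b, a) then y else gram l x i j) =
      - (y^2) * set_det U (gram l x) + \<beta> * y + \<gamma>"
    by (rule set_det_insert_pair) fact+
  then obtain \<beta> \<gamma> where "\<forall>y. set_det ?V (\<lambda>i j. if (i, j) = (a, b) \<or> (i, j) = (b, a) then y else gram l x i j) =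
      - (y^2) * set_det U (gram l x) + \<beta> * y + \<gamma>" by blast
  then show ?thesis unfolding cayley_menger_def gram by blast
qed

text \<open>Extraction of the coefficients of degree 4 and 3 in the length of the edge \<open>ab\<close> by finite differences.\<close>

lemma cayley_menger_pair_differences:
  fixes l :: "nat \<times> nat \<Rightarrow> complex"
  assumes "finite U" "a \<notin> U" "b \<notin> U" "a \<noteq> b" "x \<notin> U" "x \<noteq> a" "x \<noteq> b"
  defines "P \<equiv> \<lambda>\<tau>. cayley_menger x (insert a (insert b U)) (l(edge a b := l (edge a b) + \<tau>))"
  shows "24 * cayley_menger x U l = - 1 * P 2 + 4 * P 1 + - 6 * P 0 + 4 * P (- 1) + - 1 * P (- 2)"
    and "48 * (l (edge a b) * cayley_menger x U l) = - 1 * P 2 + 2 * P 1 + - 2 * P (- 1) + 1 * P (- 2)"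
proof -
  obtain \<beta> \<gamma> \<eta> where *: "\<And>y. cayley_menger x (insert a (insert b U)) (l(edge a b := y)) =
    - ((\<eta> - y^2)^2) * cayley_menger x U l + \<beta> * (\<eta> - y^2) + \<gamma>"
    using cayley_menger_pair[OF assms(1-7)] by blast
  show "24 * cayley_menger x U l = - 1 * P 2 + 4 * P 1 + - 6 * P 0 + 4 * P (- 1) + - 1 * P (- 2)"
    unfolding P_def * by algebra
  show "48 * (l (edge a b) * cayley_menger x U l) = - 1 * P 2 + 2 * P 1 + - 2 * P (- 1) + 1 * P (- 2)"
    unfolding P_def * by algebra
qed

section \<open>Passing to smaller vertex sets by deleting pairs\<close>

definition cm_deg_le :: "nat \<Rightarrow> nat \<Rightarrow> (nat \<times> nat \<Rightarrow> complex) \<Rightarrow> nat \<Rightarrow> nat set \<Rightarrow> bool" where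
  "cm_deg_le m n v x U \<longleftrightarrow> (\<forall>w\<in>vecs n. deg_le m (\<lambda>s. cayley_menger x U (\<lambda>e. w e + s * v e)))"

text \<open>Shifting the length of \<open>ab\<close> only moves the base point \<open>w\<close>,
  over which \<open>cm_deg_le\<close> quantifies, so the extracted coefficients obey the same degree
  bound.\<close>

lemma cm_deg_le_pair:
  assumes V: "cm_deg_le m n v x (insert a (insert b U))"
    and U: "finite U" "a \<notin> U" "b \<notin> U" "a \<noteq> b" "x \<notin> U" "x \<noteq> a" "x \<noteq> b" and n: "a < n" "b < n"
    and w: "w \<in> vecs n"
  shows "deg_le m (\<lambda>s. cayley_menger x U (\<lambda>e. w e + s * v e))"
    and "deg_le m (\<lambda>s. (w (edge a b) + s * v (edge a b)) * cayley_menger x U (\<lambda>e. w e + s * v e))"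
proof -
  define P where "P \<tau> s = cayley_menger x (insert a (insert b U))
    ((\<lambda>e. w e + s * v e)(edge a b := (w (edge a b) + s * v (edge a b)) + \<tau>))" for \<tau> s
  have P: "deg_le m (P \<tau>)" for \<tau>
  proof -
    have "w(edge a b := w (edge a b) + \<tau>) \<in> vecs n"
      using w n U(4) edge_in_edges by (auto simp: vecs_def)
    moreover have "(\<lambda>e. w e + s * v e)(edge a b := (w (edge a b) + s * v (edge a b)) + \<tau>) =
      (\<lambda>e. (w(edge a b := w (edge a b) + \<tau>)) e + s * v e)" for s
      by auto
    ultimately show ?thesis using V unfolding cm_deg_le_def P_def by auto
  qed
  note diff = cayley_menger_pair_differences[OF U, of "\<lambda>e. w e + s * v e" for s, folded P_def]
  have "deg_le m (\<lambda>s. 1 / 24 * (24 * cayley_menger x U (\<lambda>e. w e + s * v e)))"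
    unfolding diff(1) by (intro deg_le_cmult deg_le_add P)
  then show "deg_le m (\<lambda>s. cayley_menger x U (\<lambda>e. w e + s * v e))" by simp
  have "deg_le m (\<lambda>s. 1 / 48 * (48 * ((w (edge a b) + s * v (edge a b)) * cayley_menger x U (\<lambda>e. w e + s * v e))))"
    unfolding diff(2) by (intro deg_le_cmult deg_le_add P)
  then show "deg_le m (\<lambda>s. (w (edge a b) + s * v (edge a b)) * cayley_menger x U (\<lambda>e. w e + s * v e))" by simp
qed

lemma cm_deg_le_remove_pair:
  assumes "cm_deg_le m n v x (insert a (insert b U))"
    and "finite U" "a \<notin> U" "b \<notin> U" "a \<noteq> b" "x \<notin> U" "x \<noteq> a" "x \<noteq> b" "a < n" "b < n"
  shows "cm_deg_le m n v x U"
  unfolding cm_deg_le_def using cm_deg_le_pair(1)[OF assms] by blast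

lemma cayley_menger_cong:
  assumes "\<And>i j. i \<in> insert x U \<Longrightarrow> j \<in> insert x U \<Longrightarrow> l (edge i j) = l' (edge i j)"
  shows "cayley_menger x U l = cayley_menger x U l'"
  unfolding cayley_menger_def using assms by (intro set_det_cong) (auto simp: gram_def sq_len_def)

text \<open>The smaller determinant does not involve the edge \<open>ab\<close>, so \<open>w\<close>
  may be set to 0 there. The cubic coefficient then carries a factor
  \<open>s * v (edge a b)\<close>, and cancelling it lowers the bound from 2 to 1.\<close>

lemma cm_deg_le_remove_nonzero_pair:
  assumes V: "cm_deg_le 2 n v x (insert a (insert b U))"
    and U: "finite U" "a \<notin> U" "b \<notin> U" "a \<noteq> b" "x \<notin> U" "x \<noteq> a" "x \<noteq> b" "a < n" "b < n"
    and nz: "v (edge a b) \<noteq> 0"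
  shows "cm_deg_le 1 n v x U"
  unfolding cm_deg_le_def
proof
  fix w assume w: "w \<in> vecs n"
  let ?w = "w(edge a b := 0)" and ?h = "\<lambda>s. cayley_menger x U (\<lambda>e. w e + s * v e)"
  have w': "?w \<in> vecs n" using w by (auto simp: vecs_def)
  have "cayley_menger x U (\<lambda>e. ?w e + s * v e) = ?h s" for s
    using U by (intro cayley_menger_cong) (auto simp: edge_eq_iff)
  then have "deg_le 2 (\<lambda>s. (s * v (edge a b)) * ?h s)"
    using cm_deg_le_pair(2)[OF V U w'] by simp
  then obtain q where q: "degree q \<le> 2" "\<And>s. (s * v (edge a b)) * ?h s = poly q s"
    unfolding deg_le_def by blast
  obtain p where p: "\<And>s. ?h s = poly p s"
    using cm_deg_le_pair(1)[OF V U w] unfolding deg_le_def by blast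
  have "poly ([:0, v (edge a b):] * p) = poly q"
    using q(2) p by (auto simp: fun_eq_iff mult_ac)
  then have eq: "[:0, v (edge a b):] * p = q" using poly_eq_poly_eq_iff by blast
  have "degree p \<le> 1"
  proof (cases "p = 0")
    case False
    then have "degree ([:0, v (edge a b):] * p) = 1 + degree p"
      using nz by (subst degree_mult_eq) auto
    then show ?thesis using q(1) unfolding eq by simp
  qed simp
  then show "deg_le 1 ?h" unfolding deg_le_def using p by blast
qed

text \<open>The set \<open>U\<close> is enlarged by \<open>k\<close> pairs of vertices, which are
  then deleted one at a time; the size of \<open>W\<close> guarantees that the pairs fit in beside
  \<open>x\<close> and \<open>U\<close>.\<close>

lemma cm_deg_le_reduce:
  assumes "\<And>x U. x \<notin> U \<Longrightarrow> insert x U \<subseteq> W \<Longrightarrow> card U = r + 2 * k \<Longrightarrow> cm_deg_le m n v x U"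
    and "W \<subseteq> {..<n}" "r + 2 * k < card W" "x \<notin> U" "insert x U \<subseteq> W" "card U = r"
  shows "cm_deg_le m n v x U"
  using assms
proof (induction k arbitrary: x U)
  case (Suc k)
  have finW: "finite W" using Suc.prems(2) finite_subset by blast
  show ?case
  proof (rule Suc.IH[OF _ Suc.prems(2) _ Suc.prems(4,5,6)])
    show "r + 2 * k < card W" using Suc.prems(3) by simp
    fix y U' assume U': "y \<notin> U'" "insert y U' \<subseteq> W" "card U' = r + 2 * k"
    have finU: "finite U'" using U' finW finite_subset by auto
    have "card (W - insert y U') = card W - card (insert y U')"
      using U' finU by (intro card_Diff_subset) auto
    then have "2 \<le> card (W - insert y U')" using U' finU Suc.prems(3) by simp
    then obtain S where "S \<subseteq> W - insert y U'" "card S = 2"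
      using obtain_subset_with_card_n by metis
    then obtain a b where ab: "a \<in> W - insert y U'" "b \<in> W - insert y U'" "a \<noteq> b"
      by (auto simp: card_2_iff)
    have "cm_deg_le m n v y (insert a (insert b U'))"
      using U' ab finU by (intro Suc.prems(1)) auto
    then show "cm_deg_le m n v y U'"
      using ab finU U' Suc.prems(2) by (elim cm_deg_le_remove_pair) auto
  qed
qed simp

lemma set_det_1: "set_det {a} M = M a a"
  by (simp add: set_det_def permutes_sing sign_id)

lemma set_det_2: "a \<noteq> b \<Longrightarrow> set_det {a, b} M = M a a * M b b - M a b * M b a"
  unfolding set_det_def
  by (subst sum_over_permutations_insert)
    (auto simp: permutes_sing sign_id sign_swap_id Transposition.transpose_def)

lemma set_det_3:
  assumes "a \<noteq> b" "a \<noteq> c" "b \<noteq> c"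
  shows "set_det {a, b, c} M = M a a * M b b * M c c + M a b * M b c * M c a + M a c * M b a * M c b
    - M a a * M b c * M c b - M a b * M b a * M c c - M a c * M b b * M c a"
proof -
  have *: "finite {b, c}" "a \<notin> {b, c}" "finite {c}" "b \<notin> {c}" using assms by auto
  show ?thesis
    using assms
    unfolding set_det_def sum_over_permutations_insert[OF *(1,2)] sum_over_permutations_insert[OF *(3,4)]
      permutes_sing
    by (simp add: sign_swap_id permutation_swap_id sign_compose sign_id Transposition.transpose_def)
qed

section \<open>Stars are the only directions of low degree\<close>

lemma deg_le_coeff:
  assumes "deg_le m h" "\<And>s. h s = poly p s" "m < k"
  shows "coeff p k = 0"
proof -
  obtain q where q: "degree q \<le> m" "\<And>s. h s = poly q s" using assms(1) unfolding deg_le_def by blast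
  then have "poly p = poly q" using assms(2) by (auto simp: fun_eq_iff)
  then have "p = q" using poly_eq_poly_eq_iff by blast
  then show ?thesis using q(1) assms(3) by (simp add: coeff_eq_0)
qed

text \<open>Heron's formula: 16 times the squared area of a triangle, in terms of its squared side
  lengths.\<close>

definition heron :: "complex \<Rightarrow> complex \<Rightarrow> complex \<Rightarrow> complex" where
  "heron A B C = 4 * A * B - (A + B - C)^2"

text \<open>With unit length on a single edge as base point, the claims are the vanishing of the
  coefficients of \<open>s^2\<close> and \<open>s^3\<close>.\<close>

lemma heron_deg_le:
  assumes "deg_le m (\<lambda>s. heron ((1 + s * p)^2) ((s * q)^2) ((s * r)^2))"
  shows "m \<le> 1 \<Longrightarrow> 3 * p^2 = q^2 + r^2" and "m \<le> 2 \<Longrightarrow> p * (q^2 + r^2 - p^2) = 0"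
proof -
  let ?P = "[:-1, -4 * p, 2 * q^2 + 2 * r^2 - 6 * p^2, 4 * (p * (q^2 + r^2 - p^2)),
    4 * p^2 * q^2 - p^4 - 2 * p^2 * (q^2 - r^2) - (q^2 - r^2)^2:]"
  have eq: "heron ((1 + s * p)^2) ((s * q)^2) ((s * r)^2) = poly ?P s" for s
    unfolding heron_def by (simp only: poly_pCons poly_0) algebra
  show "3 * p^2 = q^2 + r^2" if "m \<le> 1"
  proof -
    have "2 * q^2 + 2 * r^2 - 6 * p^2 = 0"
      using deg_le_coeff[OF assms eq, of 2] that by (simp add: numeral_2_eq_2)
    then show ?thesis by algebra
  qed
  show "p * (q^2 + r^2 - p^2) = 0" if "m \<le> 2"
    using deg_le_coeff[OF assms eq, of 3] that by (simp add: numeral_3_eq_3)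
qed

text \<open>288 times the squared volume of a tetrahedron in terms of its squared edge lengths. The
  opposite pairs are \<open>A\<close> and \<open>H\<close>, \<open>B\<close> and \<open>G\<close>,
  \<open>C\<close> and \<open>F\<close>.\<close>

definition tetra :: "complex \<Rightarrow> complex \<Rightarrow> complex \<Rightarrow> complex \<Rightarrow> complex \<Rightarrow> complex \<Rightarrow> complex" where
  "tetra A B C F G H = 2 * (B * G * (A + H + C + F - B - G) + A * H * (B + G + C + F - A - H) +
    C * F * (A + H + B + G - C - F) - A * B * F - B * C * H - A * C * G - F * G * H)"

lemma cayley_menger_1: "cayley_menger x {a} l = 2 * sq_len l x a"
  by (simp add: cayley_menger_def set_det_1 gram_def) (simp add: sq_len_def)

lemma cayley_menger_2: "a \<noteq> b \<Longrightarrow> cayley_menger x {a, b} l = heron (sq_len l x a) (sq_len l x b) (sq_len l a b)"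
  by (simp add: cayley_menger_def set_det_2 gram_def heron_def sq_len_commute[of l b a]) (simp add: sq_len_def power2_eq_square algebra_simps)

lemma cayley_menger_3:
  assumes "a \<noteq> b" "a \<noteq> c" "b \<noteq> c"
  shows "cayley_menger x {a, b, c} l = tetra (sq_len l x a) (sq_len l x b) (sq_len l x c) (sq_len l a b) (sq_len l a c) (sq_len l b c)"
proof -
  have z: "sq_len l i i = 0" for i by (simp add: sq_len_def)
  show ?thesis
    unfolding cayley_menger_def set_det_3[OF assms] gram_def tetra_def sq_len_commute[of l b a] sq_len_commute[of l c a]
      sq_len_commute[of l c b] z
    by algebra
qed

text \<open>The coefficient of \<open>s^3\<close> has to vanish; comparing it for the two signs of
  \<open>t\<close> isolates the part that is odd in \<open>t\<close>.\<close>

lemma tetra_deg_le_adjacent: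
  assumes "q * g = 0" "r * f = 0"
    and "\<And>t. t \<in> {1, -1} \<Longrightarrow>
      deg_le 2 (\<lambda>s. tetra ((t + s * p)^2) ((1 + s * q)^2) ((s * r)^2) ((s * f)^2) ((s * g)^2) 0)"
  shows "p * (g^2 - f^2) = 0"
proof -
  have *: "2 * t * p * g^2 = f^2 * (2 * t * p + 2 * q * t^2)" if t: "t \<in> {1, -1}" for t
  proof -
    let ?A = "[:t, p:]^2" and ?B = "[:1, q:]^2" and ?C = "[:0, 0, r^2:]" and ?F = "[:0, 0, f^2:]" and ?G = "[:0, 0, g^2:]"
    let ?P = "[:2:] * (?B * ?G * (?A + ?C + ?F - ?B - ?G) - ?A * ?B * ?F - ?A * ?C * ?G)"
    have "tetra ((t + s * p)^2) ((1 + s * q)^2) ((s * r)^2) ((s * f)^2) ((s * g)^2) 0 = poly ?P s" for s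
    proof -
      have *: "(s * r)^2 * (s * f)^2 = 0" using assms(2) by auto
      have "poly ?P s = 2 * ((1 + s * q)^2 * (s * g)^2 * ((t + s * p)^2 + (s * r)^2 + (s * f)^2 - (1 + s * q)^2 - (s * g)^2)
        - (t + s * p)^2 * (1 + s * q)^2 * (s * f)^2 - (t + s * p)^2 * (s * r)^2 * (s * g)^2)"
        unfolding poly_mult poly_add poly_diff poly_power poly_pCons poly_0 by algebra
      then show ?thesis unfolding tetra_def using * by algebra
    qed
    from deg_le_coeff[OF assms(3)[OF t] this, of 3]
    have "2 * (g^2 * (2 * q * t^2 + 2 * t * p - 4 * q) - f^2 * (2 * t * p + 2 * q * t^2)) = 0"
      by (simp add: numeral_3_eq_3 power2_eq_square algebra_simps)
    then show ?thesis using assms(1) by algebra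
  qed
  from *[of 1] *[of "-1"] show ?thesis by simp algebra
qed

text \<open>The property that singles out stars. Quantifying over all vanishing polynomials of the
  degree, not only over determinants, makes it invariant under automorphisms.\<close>

definition low_degree :: "nat \<Rightarrow> nat \<Rightarrow> (nat \<times> nat \<Rightarrow> complex) \<Rightarrow> bool" where
  "low_degree d n v \<longleftrightarrow> (\<forall>F. hom_poly (edges n) (2 * d + 2) F \<longrightarrow> (\<forall>l\<in>unsq_meas_variety d n. F l = 0) \<longrightarrow>
    (\<forall>w\<in>vecs n. deg_le 2 (\<lambda>s. F (\<lambda>e. w e + s * v e))))"

lemma low_degreeD:
  assumes "low_degree d n v" "hom_poly (edges n) (2 * d + 2) F" "\<And>l. l \<in> unsq_meas_variety d n \<Longrightarrow> F l = 0"
    "w \<in> vecs n"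
  shows "deg_le 2 (\<lambda>s. F (\<lambda>e. w e + s * v e))"
  using assms unfolding low_degree_def by blast

lemma low_degree_cm_deg_le:
  assumes "low_degree d n v" "insert x U \<subseteq> {..<n}" "card U = d + 1"
  shows "cm_deg_le 2 n v x U"
  unfolding cm_deg_le_def
proof
  fix w assume w: "w \<in> vecs n"
  show "deg_le 2 (\<lambda>s. cayley_menger x U (\<lambda>e. w e + s * v e))"
  proof (rule low_degreeD[OF assms(1) _ _ w])
    show "hom_poly (edges n) (2 * d + 2) (cayley_menger x U)" using hom_poly_cayley_menger[of x n U] assms(2,3) by simp
    show "cayley_menger x U l = 0" if "l \<in> unsq_meas_variety d n" for l
      using that assms(2,3) by (intro cayley_menger_vanish) auto
  qed
qed

lemma cm_deg_leD: "cm_deg_le m n v x U \<Longrightarrow> w \<in> vecs n \<Longrightarrow> deg_le m (\<lambda>s. cayley_menger x U (\<lambda>e. w e + s * v e))"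
  unfolding cm_deg_le_def by blast

lemma unit_in_vecs: "a < n \<Longrightarrow> b < n \<Longrightarrow> a \<noteq> b \<Longrightarrow> (\<lambda>e. if e = edge a b then c else 0) \<in> vecs n"
  using edge_in_edges by (auto simp: vecs_def)

lemma cm_deg_le_triangle:
  assumes "cm_deg_le m n v x {a, b}" "x < n" "a < n" "x \<noteq> a" "x \<noteq> b" "a \<noteq> b"
  shows "deg_le m (\<lambda>s. heron ((1 + s * v (edge x a))^2) ((s * v (edge x b))^2) ((s * v (edge a b))^2))"
proof -
  let ?w = "\<lambda>e. if e = edge x a then 1 else 0"
  have "deg_le m (\<lambda>s. cayley_menger x {a, b} (\<lambda>e. ?w e + s * v e))"
    by (rule cm_deg_leD[OF assms(1) unit_in_vecs[OF assms(2-4)]])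
  then show ?thesis using assms(4-6) by (simp add: cayley_menger_2 sq_len_def edge_eq_iff)
qed

text \<open>Deleting the non-zero edge \<open>ab\<close> leaves determinants of degree at most 1 on
  the other vertices. Deleting further pairs reduces these to one squared length for even
  \<open>d\<close> and to triangles for odd \<open>d\<close>, and either forces \<open>v\<close> to
  vanish there.\<close>

lemma low_degree_disjoint:
  assumes good: "low_degree d n v" and d: "d \<ge> 2" "n \<ge> d + 2"
    and ab: "a < n" "b < n" "a \<noteq> b" "v (edge a b) \<noteq> 0"
    and xy: "x < n" "y < n" "x \<noteq> y" "x \<notin> {a, b}" "y \<notin> {a, b}"
  shows "v (edge x y) = 0"
proof -
  let ?W = "{..<n} - {a, b}"
  have cardW: "card ?W = n - 2" using ab by (simp add: card_Diff_subset)
  have deg1: "cm_deg_le 1 n v z U" if "z \<notin> U" "insert z U \<subseteq> ?W" "card U = d - 1" for z U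
  proof -
    have finU: "finite U" using that(2) by (meson finite_subset finite_Diff finite_lessThan insert_subset)
    have "a \<notin> U" "b \<notin> U" using that(2) by auto
    then have "cm_deg_le 2 n v z (insert a (insert b U))"
      using that finU ab d by (intro low_degree_cm_deg_le[OF good]) auto
    then show ?thesis
      using that finU ab by (elim cm_deg_le_remove_nonzero_pair) auto
  qed
  have reduce: "cm_deg_le 1 n v z U" if "d - 1 = r + 2 * k" "z \<notin> U" "insert z U \<subseteq> ?W" "card U = r" for r k z U
  proof (rule cm_deg_le_reduce[where W = ?W and k = k])
    show "r + 2 * k < card ?W" using that(1) cardW d by linarith
    show "cm_deg_le 1 n v z' U'" if "z' \<notin> U'" "insert z' U' \<subseteq> ?W" "card U' = r + 2 * k" for z' U'
      using that \<open>d - 1 = r + 2 * k\<close> by (intro deg1) simp_all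
  qed (use that in auto)
  show ?thesis
  proof (cases "even d")
    case True
    have "\<exists>k. d - 1 = 1 + 2 * k" using True d by presburger
    then obtain k where k: "d - 1 = 1 + 2 * k" ..
    have "cm_deg_le 1 n v x {y}" using xy by (intro reduce[OF k]) auto
    then have "deg_le 1 (\<lambda>s. cayley_menger x {y} (\<lambda>e. 0 + s * v e))"
      by (rule cm_deg_leD) (simp add: vecs_def)
    then have "deg_le 1 (\<lambda>s. 2 * (s * v (edge x y))^2)" using xy by (simp add: cayley_menger_1 sq_len_def)
    from deg_le_coeff[OF this, of "[:0, 0, 2 * (v (edge x y))^2:]" 2] show ?thesis
      by (simp add: power2_eq_square algebra_simps numeral_2_eq_2)
  next
    case False
    have "\<exists>k. d - 1 = 2 + 2 * k" using False d by presburger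
    then obtain k where k: "d - 1 = 2 + 2 * k" ..
    \<comment> \<open>Here \<open>d \<ge> 3\<close>, so a fifth vertex is available to complete
      \<open>x\<close>, \<open>y\<close> to a triangle that avoids \<open>a\<close> and
      \<open>b\<close>.\<close>
    have "card ({..<n} - {a, b, x, y}) \<ge> n - card {a, b, x, y}"
      by (metis card_lessThan diff_card_le_card_Diff finite.emptyI finite.insertI)
    moreover have "card {a, b, x, y} \<le> 4" by (simp add: card_insert_if)
    moreover have "n \<ge> 5" using k d by simp
    ultimately have "card ({..<n} - {a, b, x, y}) \<noteq> 0" by linarith
    then obtain z where z: "z < n" "z \<notin> {a, b, x, y}" by (metis DiffE card.empty ex_in_conv lessThan_iff)
    have tri: "3 * (v (edge i j))^2 = (v (edge i h))^2 + (v (edge j h))^2"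
      if "i \<in> ?W" "j \<in> ?W" "h \<in> ?W" "i \<noteq> j" "i \<noteq> h" "j \<noteq> h" for i j h
    proof -
      have "cm_deg_le 1 n v i {j, h}" using that by (intro reduce[OF k]) auto
      from heron_deg_le(1)[OF cm_deg_le_triangle[OF this]] show ?thesis using that by auto
    qed
    have W: "x \<in> ?W" "y \<in> ?W" "z \<in> ?W" "x \<noteq> z" "y \<noteq> z" using xy z by auto
    have "3 * (v (edge x y))^2 = (v (edge x z))^2 + (v (edge y z))^2"
      "3 * (v (edge x z))^2 = (v (edge x y))^2 + (v (edge y z))^2"
      "3 * (v (edge y z))^2 = (v (edge x y))^2 + (v (edge x z))^2"
      using tri[of x y z] tri[of x z y] tri[of y z x] W xy(3) by (auto simp: edge_commute)
    then have "4 * (v (edge x y))^2 = 0" by algebra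
    then show ?thesis by simp
  qed
qed

section \<open>Recognizing stars from conditions on small vertex sets\<close>

lemma obtain_new_vertex:
  assumes "finite S" "card S < n"
  obtains z where "z < (n::nat)" "z \<notin> S"
proof -
  have "\<not> {..<n} \<subseteq> S"
    using assms card_mono[of S "{..<n}"] by auto
  then show thesis using that by auto
qed

lemma starI:
  assumes "v \<in> vecs n" "z < n" "c \<noteq> 0" "\<And>j. j < n \<Longrightarrow> j \<noteq> z \<Longrightarrow> (v (edge z j))^2 = c"
    "\<And>i j. i < n \<Longrightarrow> j < n \<Longrightarrow> i \<noteq> j \<Longrightarrow> i \<noteq> z \<Longrightarrow> j \<noteq> z \<Longrightarrow> v (edge i j) = 0"
  shows "star n z v"
proof -
  have "v (i, j) = 0" if "i \<noteq> z" "j \<noteq> z" for i j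
  proof (cases "(i, j) \<in> edges n")
    case True
    then have "i < n" "j < n" "i \<noteq> j" "edge i j = (i, j)" by (auto simp: edges_def edge_def)
    then show ?thesis using assms(5)[of i j] that by simp
  next
    case False
    then show ?thesis using assms(1) by (simp add: vecs_def)
  qed
  then show ?thesis unfolding star_def using assms(1-4) by blast
qed

lemma vecs_nonzero_entry:
  assumes "v \<in> vecs n" "v \<noteq> (\<lambda>_. 0)"
  obtains x y where "x < n" "y < n" "x \<noteq> y" "v (edge x y) \<noteq> 0"
proof -
  obtain e where e: "v e \<noteq> 0" using assms(2) unfolding fun_eq_iff by blast
  then have "e \<in> edges n" using assms(1) unfolding vecs_def by blast
  then obtain i j where "e = (i, j)" "i < j" "j < n" by (rule edgesE)
  then show thesis using that[of i j] e by (simp add: edge_def)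
qed

text \<open>Two edges of the support always meet. Condition \<open>adj\<close> spreads the common
  square over all edges at the center and excludes triangles, since an edge from a corner to a
  fourth vertex would be disjoint from the opposite side; \<open>single\<close> excludes an isolated
  edge.\<close>

lemma star_from_tetrahedra:
  assumes v: "v \<in> vecs n" "v \<noteq> (\<lambda>_. 0)" and n: "n \<ge> 4"
    and disj: "\<And>x y z u. {x, y, z, u} \<subseteq> {..<n} \<Longrightarrow> distinct [x, y, z, u] \<Longrightarrow> v (edge x y) \<noteq> 0 \<Longrightarrow> v (edge z u) = 0"
    and adj: "\<And>x y z u. {x, y, z, u} \<subseteq> {..<n} \<Longrightarrow> distinct [x, y, z, u] \<Longrightarrow> v (edge x y) \<noteq> 0 \<Longrightarrow>
      (v (edge y z))^2 = (v (edge y u))^2"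
    and single: "\<And>x y z u. {x, y, z, u} \<subseteq> {..<n} \<Longrightarrow> distinct [x, y, z, u] \<Longrightarrow> v (edge x y) \<noteq> 0 \<Longrightarrow>
      v (edge x z) = 0 \<Longrightarrow> v (edge x u) = 0 \<Longrightarrow> v (edge y z) = 0 \<Longrightarrow> v (edge y u) = 0 \<Longrightarrow> False"
  shows "\<exists>z. star n z v"
proof -
  have star: "star n x v" if xyz: "{x, y, z} \<subseteq> {..<n}" "distinct [x, y, z]" and
    nz: "v (edge x y) \<noteq> 0" "v (edge x z) \<noteq> 0" "v (edge y z) = 0" for x y z
  proof (rule starI[OF v(1)])
    have "card {x, y, z} < n" using n by (simp add: card_insert_if)
    then obtain u where u: "u < n" "u \<notin> {x, y, z}"
      by (rule obtain_new_vertex[rotated]) auto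
    show "x < n" "(v (edge x y))^2 \<noteq> 0" using xyz nz by auto
    have yz: "(v (edge x z))^2 = (v (edge x y))^2"
      using adj[of z x y u] adj[of y x z u] xyz u nz by (simp add: edge_commute)
    show "(v (edge x j))^2 = (v (edge x y))^2" if "j < n" "j \<noteq> x" for j
      using adj[of y x z j] yz that xyz nz by (cases "j = y"; cases "j = z") (auto simp: edge_commute)
    show "v (edge i j) = 0" if ij: "i < n" "j < n" "i \<noteq> j" "i \<noteq> x" "j \<noteq> x" for i j
    proof -
      have y0: "v (edge y k) = 0" if "k < n" "k \<noteq> x" "k \<noteq> y" for k
        using adj[of x y z k] that xyz nz by (cases "k = z") auto
      consider "i = y" | "j = y" | "i \<noteq> y" "j \<noteq> y" by blast
      then show ?thesis
      proof cases
        case 3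
        then show ?thesis using disj[of x y i j] ij xyz nz by auto
      qed (use y0 ij in \<open>auto simp: edge_commute\<close>)
    qed
  qed
  obtain x y where xy: "x < n" "y < n" "x \<noteq> y" "v (edge x y) \<noteq> 0"
    using vecs_nonzero_entry[OF v] by blast
  have "card {x, y} < n" using n by (simp add: card_insert_if)
  then obtain z where z: "z < n" "z \<notin> {x, y}" by (rule obtain_new_vertex[rotated]) auto
  have "card {x, y, z} < n" using n by (simp add: card_insert_if)
  then obtain u where u: "u < n" "u \<notin> {x, y, z}" by (rule obtain_new_vertex[rotated]) auto
  have sub: "{x, y, z, u} \<subseteq> {..<n}" "distinct [x, y, z, u]" "{y, x, z, u} \<subseteq> {..<n}" "distinct [y, x, z, u]"
    using xy z u by auto
  have y: "(v (edge y z))^2 = (v (edge y u))^2" and x: "(v (edge x z))^2 = (v (edge x u))^2"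
    using adj[OF sub(1,2)] adj[OF sub(3,4)] xy by (auto simp: edge_commute)
  \<comment> \<open>If \<open>xz\<close> and \<open>yz\<close> were both non-zero, so would be
    \<open>yu\<close>, which is disjoint from \<open>xz\<close>.\<close>
  have "v (edge x z) = 0 \<or> v (edge y u) = 0"
    using disj[of x z y u] sub by auto
  moreover have "v (edge y z) = 0 \<longleftrightarrow> v (edge y u) = 0" using y by (metis zero_eq_power2)
  ultimately consider "v (edge x z) = 0" "v (edge y z) = 0" | "v (edge x z) \<noteq> 0" "v (edge y z) = 0"
    | "v (edge x z) = 0" "v (edge y z) \<noteq> 0"
    by blast
  then show ?thesis
  proof cases
    case 1
    then show ?thesis using single[OF sub(1,2)] xy x y by auto
  next
    case 2
    then show ?thesis using star[of x y z] sub xy by auto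
  next
    case 3
    then show ?thesis using star[of y x z] sub xy by (auto simp: edge_commute)
  qed
qed

text \<open>By \<open>tri\<close>, a triangle that meets the support has exactly two non-zero edges,
  with equal squares. So \<open>v\<close> looks like the cut between two parts of the vertices, and
  \<open>cut\<close> excludes that both parts have two elements.\<close>

lemma star_from_triangles:
  assumes v: "v \<in> vecs n" "v \<noteq> (\<lambda>_. 0)" and n: "n \<ge> 3"
    and tri: "\<And>x y z. {x, y, z} \<subseteq> {..<n} \<Longrightarrow> distinct [x, y, z] \<Longrightarrow> v (edge x y) \<noteq> 0 \<Longrightarrow>
      (v (edge x y))^2 = (v (edge x z))^2 + (v (edge y z))^2"
    and cut: "\<And>x y z u. {x, y, z, u} \<subseteq> {..<n} \<Longrightarrow> distinct [x, y, z, u] \<Longrightarrow> v (edge x y) \<noteq> 0 \<Longrightarrow>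
      (v (edge x z))^2 = (v (edge x y))^2 \<Longrightarrow> (v (edge y u))^2 = (v (edge x y))^2 \<Longrightarrow> (v (edge z u))^2 = (v (edge x y))^2 \<Longrightarrow>
      v (edge x u) = 0 \<Longrightarrow> v (edge y z) = 0 \<Longrightarrow> False"
  shows "\<exists>z. star n z v"
proof -
  obtain x y where xy: "x < n" "y < n" "x \<noteq> y" "v (edge x y) \<noteq> 0"
    using vecs_nonzero_entry[OF v] by blast
  let ?c = "(v (edge x y))^2"
  have dich: "v (edge j k) = 0 \<and> (v (edge i k))^2 = (v (edge i j))^2 \<or> v (edge i k) = 0 \<and> (v (edge j k))^2 = (v (edge i j))^2"
    if "{i, j, k} \<subseteq> {..<n}" "distinct [i, j, k]" "v (edge i j) \<noteq> 0" for i j k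
  proof (cases "v (edge i k) = 0")
    case True
    then show ?thesis using tri[OF that] by auto
  next
    case False
    have "(v (edge i j))^2 = (v (edge i k))^2 + (v (edge j k))^2" by (rule tri[OF that])
    moreover have "(v (edge i k))^2 = (v (edge i j))^2 + (v (edge j k))^2"
      using tri[of i k j] that False by (auto simp: edge_commute)
    ultimately have "2 * (v (edge j k))^2 = 0" by algebra
    then show ?thesis using \<open>(v (edge i j))^2 = _\<close> by simp
  qed
  have star: "star n i v" if "i < n" "j < n" "i \<noteq> j" "v (edge i j) \<noteq> 0"
    and all: "\<And>k. k < n \<Longrightarrow> k \<noteq> i \<Longrightarrow> (v (edge i k))^2 = (v (edge i j))^2" for i j
  proof (rule starI[OF v(1) that(1) _ all])
    show "(v (edge i j))^2 \<noteq> 0" using that(4) by simp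
    show "v (edge k h) = 0" if "k < n" "h < n" "k \<noteq> h" "k \<noteq> i" "h \<noteq> i" for k h
    proof -
      have "(v (edge i k))^2 = (v (edge i j))^2" "(v (edge i h))^2 = (v (edge i j))^2" using all that by auto
      moreover from this \<open>v (edge i j) \<noteq> 0\<close> have "v (edge i k) \<noteq> 0" "v (edge i h) \<noteq> 0" by auto
      ultimately show ?thesis using dich[of i k h] that \<open>i < n\<close> by auto
    qed
  qed
  consider "\<And>k. k < n \<Longrightarrow> k \<noteq> x \<Longrightarrow> (v (edge x k))^2 = ?c" | "\<And>k. k < n \<Longrightarrow> k \<noteq> y \<Longrightarrow> (v (edge y k))^2 = ?c"
    | z u where "z < n" "z \<noteq> x" "(v (edge x z))^2 \<noteq> ?c" "u < n" "u \<noteq> y" "(v (edge y u))^2 \<noteq> ?c"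
    by blast
  then show ?thesis
  proof cases
    case 1
    have "star n x v" by (rule star[OF xy 1])
    then show ?thesis ..
  next
    case 2
    have "star n y v"
      by (rule star[of y x]) (use xy 2 in \<open>simp_all add: edge_commute[of y x]\<close>)
    then show ?thesis ..
  next
    case 3
    \<comment> \<open>Here \<open>z\<close> lies on the side of \<open>x\<close> and
      \<open>u\<close> on the side of \<open>y\<close>: neither side is a single vertex.\<close>
    have ne: "z \<noteq> y" "u \<noteq> x" using 3 by (auto simp: edge_commute)
    have z: "v (edge x z) = 0" "(v (edge y z))^2 = ?c" using dich[of x y z] 3 xy ne by auto
    have u: "v (edge y u) = 0" "(v (edge x u))^2 = ?c" using dich[of x y u] 3 xy ne by auto
    have zu: "z \<noteq> u" using z u xy(4) by auto
    have "v (edge x u) \<noteq> 0" using u(2) xy(4) by auto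
    then have "(v (edge z u))^2 = ?c"
      using dich[of x u z] 3 xy ne zu z u by (auto simp: edge_commute)
    then have False
      using cut[of x y u z] 3 xy ne zu z u by (auto simp: edge_commute)
    then show ?thesis ..
  qed
qed

text \<open>The \<open>2 \<times> 2\<close> minor of inner products of \<open>p\<^sub>u - p\<^sub>x\<close>, \<open>p\<^sub>y - p\<^sub>x\<close> with \<open>p\<^sub>z - p\<^sub>y\<close>, \<open>p\<^sub>y - p\<^sub>x\<close>. Triangles alone
  do not exclude the cut vectors of a partition of the vertices into two parts.\<close>

definition cut_minor :: "nat \<Rightarrow> nat \<Rightarrow> nat \<Rightarrow> nat \<Rightarrow> (nat \<times> nat \<Rightarrow> complex) \<Rightarrow> complex" where
  "cut_minor x y z u l = (sq_len l x z + sq_len l u y - sq_len l x y - sq_len l u z) * (2 * sq_len l x y)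
    - (sq_len l x u + sq_len l x y - sq_len l u y) * (sq_len l x z - sq_len l x y - sq_len l y z)"

lemma cut_minor_vanish:
  assumes "l \<in> unsq_meas_variety 1 n" "{x, y, z, u} \<subseteq> {..<n}"
  shows "cut_minor x y z u l = 0"
proof -
  obtain p where "\<forall>i<n. \<forall>j<n. sq_len l i j = (\<Sum>k<(1::nat). (p i k - p j k)^2)"
    using sq_len_variety[OF assms(1)] ..
  then have p: "\<And>i j. i < n \<Longrightarrow> j < n \<Longrightarrow> sq_len l i j = (p i 0 - p j 0)^2" by simp
  have "sq_len l x z + sq_len l u y - sq_len l x y - sq_len l u z = 2 * (p u 0 - p x 0) * (p z 0 - p y 0)"
    "sq_len l x u + sq_len l x y - sq_len l u y = 2 * (p u 0 - p x 0) * (p y 0 - p x 0)"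
    "sq_len l x z - sq_len l x y - sq_len l y z = 2 * (p z 0 - p y 0) * (p y 0 - p x 0)"
    "sq_len l x y = (p y 0 - p x 0)^2"
    using assms(2) by (simp_all add: p power2_eq_square algebra_simps)
  then show ?thesis unfolding cut_minor_def by algebra
qed

text \<open>With base length 1 on \<open>xy\<close> and \<open>p = v (edge x y)\<close>, the minor
  along a four-cycle of equal squares is \<open>(s * p)^4 - (1 + s * p)^4\<close>, whose cubic term
  survives.\<close>

lemma low_degree_no_cut:
  assumes good: "low_degree 1 n v" and xyzu: "{x, y, z, u} \<subseteq> {..<n}" "distinct [x, y, z, u]"
    and nz: "v (edge x y) \<noteq> 0" and c: "(v (edge x z))^2 = (v (edge x y))^2" "(v (edge y u))^2 = (v (edge x y))^2"
      "(v (edge z u))^2 = (v (edge x y))^2" "v (edge x u) = 0" "v (edge y z) = 0"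
  shows False
proof -
  let ?w = "\<lambda>e. if e = edge x y then 1 else 0" and ?p = "v (edge x y)"
  have hom_poly: "hom_poly (edges n) (2 * 1 + 2) (cut_minor x y z u)"
  proof -
    have "hom_poly (edges n) (2 + 2) (cut_minor x y z u)"
      unfolding cut_minor_def using xyzu
      by (intro hom_poly_diff hom_poly_mult hom_poly_cmult hom_poly_add hom_poly_sq_len) auto
    then show ?thesis by (simp del: hom_poly.simps)
  qed
  have "deg_le 2 (\<lambda>s. cut_minor x y z u (\<lambda>e. ?w e + s * v e))"
    using xyzu by (intro low_degreeD[OF good hom_poly cut_minor_vanish unit_in_vecs]) auto
  moreover have "cut_minor x y z u (\<lambda>e. ?w e + s * v e) = poly [:-1, -4 * ?p, -6 * ?p^2, -4 * ?p^3:] s" for s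
  proof -
    have "sq_len (\<lambda>e. ?w e + s * v e) x z = s^2 * ?p^2" "sq_len (\<lambda>e. ?w e + s * v e) u y = s^2 * ?p^2"
      "sq_len (\<lambda>e. ?w e + s * v e) u z = s^2 * ?p^2" "sq_len (\<lambda>e. ?w e + s * v e) x u = 0"
      "sq_len (\<lambda>e. ?w e + s * v e) y z = 0" "sq_len (\<lambda>e. ?w e + s * v e) x y = (1 + s * ?p)^2"
      using xyzu(2) c by (auto simp: sq_len_def edge_eq_iff edge_commute[of u] power_mult_distrib)
    then show ?thesis
      unfolding cut_minor_def by (simp add: power2_eq_square power3_eq_cube algebra_simps)
  qed
  ultimately have "coeff [:-1, -4 * ?p, -6 * ?p^2, -4 * ?p^3:] 3 = 0"
    by (rule deg_le_coeff) simp
  then show False using nz by (simp add: numeral_3_eq_3)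
qed

text \<open>Deleting pairs from \<open>d + 1\<close> vertices, apart from the base vertex, ends with
  three for even \<open>d\<close> and with two for odd \<open>d\<close>. This leaves conditions on
  tetrahedra and triangles, respectively.\<close>

theorem low_degree_star:
  assumes d: "d \<ge> 1" and n: "n \<ge> d + 2" and good: "low_degree d n v" and v: "v \<in> vecs n" "v \<noteq> (\<lambda>_. 0)"
  shows "\<exists>z. star n z v"
proof (cases "even d")
  case True
  then have d2: "d \<ge> 2" and n4: "n \<ge> 4" using d n by (auto elim!: evenE)
  obtain k where k: "d + 1 = 3 + 2 * k"
  proof -
    have "\<exists>k. d + 1 = 3 + 2 * k" using True d2 by presburger
    then show thesis using that by blast
  qed
  have cm3: "cm_deg_le 2 n v x {a, b, c}" if "{x, a, b, c} \<subseteq> {..<n}" "distinct [x, a, b, c]" for x a b c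
  proof (rule cm_deg_le_reduce[where W = "{..<n}" and k = k and r = 3])
    show "cm_deg_le 2 n v y U" if "y \<notin> U" "insert y U \<subseteq> {..<n}" "card U = 3 + 2 * k" for y U
      using that k by (intro low_degree_cm_deg_le[OF good]) auto
  qed (use that k n in auto)
  have disj: "v (edge z u) = 0" if "{x, y, z, u} \<subseteq> {..<n}" "distinct [x, y, z, u]" "v (edge x y) \<noteq> 0" for x y z u
    using that by (intro low_degree_disjoint[OF good d2 n, of x y]) auto
  show ?thesis
  proof (rule star_from_tetrahedra[OF v n4])
    fix x y z u assume xyzu: "{x, y, z, u} \<subseteq> {..<n}" "distinct [x, y, z, u]" and nz: "v (edge x y) \<noteq> 0"
    then have zu: "v (edge z u) = 0" by (rule disj)
    then show "v (edge z u) = 0" .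
    have opp: "v (edge x z) * v (edge y u) = 0" "v (edge x u) * v (edge y z) = 0"
      using disj[of x z y u] disj[of x u y z] xyzu by auto
    have "v (edge x y) * ((v (edge y u))^2 - (v (edge y z))^2) = 0"
    proof (rule tetra_deg_le_adjacent[OF opp])
      fix t :: complex assume "t \<in> {1, -1}"
      \<comment> \<open>The base point has lengths \<open>t\<close> and 1 on two edges at
        \<open>x\<close>, as \<open>tetra_deg_le_adjacent\<close> requires.\<close>
      let ?w = "\<lambda>e. if e = edge x z then 1 else if e = edge x y then t else 0"
      have "?w \<in> vecs n" using xyzu edge_in_edges by (auto simp: vecs_def)
      moreover have "cm_deg_le 2 n v x {y, z, u}" using xyzu by (intro cm3) auto
      ultimately have "deg_le 2 (\<lambda>s. cayley_menger x {y, z, u} (\<lambda>e. ?w e + s * v e))" by (intro cm_deg_leD)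
      then show "deg_le 2 (\<lambda>s. tetra ((t + s * v (edge x y))^2) ((1 + s * v (edge x z))^2) ((s * v (edge x u))^2)
        ((s * v (edge y z))^2) ((s * v (edge y u))^2) 0)"
        using xyzu(2) zu by (simp add: cayley_menger_3 sq_len_def edge_eq_iff)
    qed
    then show "(v (edge y z))^2 = (v (edge y u))^2" using nz by simp
    assume z: "v (edge x z) = 0" "v (edge x u) = 0" "v (edge y z) = 0" "v (edge y u) = 0"
    have "cm_deg_le 2 n v x {y, z, u}" using xyzu by (intro cm3) auto
    \<comment> \<open>For an isolated edge the base point sits on the opposite edge, which makes the
      term of degree 4 visible.\<close>
    then have "deg_le 2 (\<lambda>s. cayley_menger x {y, z, u} (\<lambda>e. (if e = edge z u then 1 else 0) + s * v e))"
      using xyzu by (intro cm_deg_leD unit_in_vecs) auto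
    moreover have "cayley_menger x {y, z, u} (\<lambda>e. (if e = edge z u then 1 else 0) + s * v e) =
      poly [:0, 0, -2 * (v (edge x y))^2, 0, -2 * (v (edge x y))^4:] s" for s
    proof -
      have "cayley_menger x {y, z, u} (\<lambda>e. (if e = edge z u then 1 else 0) + s * v e) = tetra ((s * v (edge x y))^2) 0 0 0 0 1"
        using xyzu(2) zu z by (simp add: cayley_menger_3 sq_len_def edge_eq_iff)
      also have "\<dots> = poly [:0, 0, -2 * (v (edge x y))^2, 0, -2 * (v (edge x y))^4:] s"
        unfolding tetra_def by (simp only: poly_pCons poly_0) algebra
      finally show ?thesis .
    qed
    ultimately have "coeff [:0, 0, -2 * (v (edge x y))^2, 0, -2 * (v (edge x y))^4:] 4 = 0"
      by (rule deg_le_coeff) simp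
    then show False using nz by (simp add: eval_nat_numeral)
  qed
next
  case False
  obtain k where k: "d + 1 = 2 + 2 * k"
  proof -
    have "\<exists>k. d + 1 = 2 + 2 * k" using False by presburger
    then show thesis using that by blast
  qed
  have cm2: "cm_deg_le 2 n v x {a, b}" if "{x, a, b} \<subseteq> {..<n}" "distinct [x, a, b]" for x a b
  proof (rule cm_deg_le_reduce[where W = "{..<n}" and k = k and r = 2])
    show "cm_deg_le 2 n v y U" if "y \<notin> U" "insert y U \<subseteq> {..<n}" "card U = 2 + 2 * k" for y U
      using that k by (intro low_degree_cm_deg_le[OF good]) auto
  qed (use that k n in auto)
  show ?thesis
  proof (rule star_from_triangles[OF v])
    show "n \<ge> 3" using d n by simp
    show "(v (edge x y))^2 = (v (edge x z))^2 + (v (edge y z))^2"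
      if "{x, y, z} \<subseteq> {..<n}" "distinct [x, y, z]" "v (edge x y) \<noteq> 0" for x y z
    proof -
      have "deg_le 2 (\<lambda>s. heron ((1 + s * v (edge x y))^2) ((s * v (edge x z))^2) ((s * v (edge y z))^2))"
        by (rule cm_deg_le_triangle[OF cm2]) (use that in auto)
      from heron_deg_le(2)[OF this] that(3) show ?thesis by auto
    qed
    fix x y z u assume xyzu: "{x, y, z, u} \<subseteq> {..<n}" "distinct [x, y, z, u]" and nz: "v (edge x y) \<noteq> 0"
      and c: "(v (edge x z))^2 = (v (edge x y))^2" "(v (edge y u))^2 = (v (edge x y))^2"
      "(v (edge z u))^2 = (v (edge x y))^2" "v (edge x u) = 0" "v (edge y z) = 0"
    show False
    \<comment> \<open>For odd \<open>d \<ge> 3\<close>, the disjoint edges \<open>xy\<close> and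
      \<open>zu\<close> cannot both be in the support; only \<open>d = 1\<close> calls for
      \<open>cut_minor\<close>.\<close>
    proof (cases "d = 1")
      case True
      show ?thesis by (rule low_degree_no_cut[OF good[unfolded True] xyzu nz c])
    next
      case False
      have "v (edge z u) = 0"
        using xyzu nz False d n by (intro low_degree_disjoint[OF good, of x y]) auto
      then show ?thesis using c nz by simp
    qed
  qed
qed

section \<open>Automorphisms permute the stars\<close>

lemma vecsD: "v \<in> vecs n \<Longrightarrow> e \<notin> edges n \<Longrightarrow> v e = 0"
  unfolding vecs_def by blast

lemma mat_apply_in_vecs: "mat_apply n A v \<in> vecs n"
  by (simp add: mat_apply_def vecs_def)

lemma mat_apply_linear:
  "mat_apply n A (\<lambda>e. a * x e + b * y e) = (\<lambda>e. a * mat_apply n A x e + b * mat_apply n A y e)"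
  by (auto simp: mat_apply_def fun_eq_iff sum.distrib sum_distrib_left algebra_simps)

lemma vecs_linear: "x \<in> vecs n \<Longrightarrow> y \<in> vecs n \<Longrightarrow> (\<lambda>e. a * x e + b * y e) \<in> vecs n"
  by (simp add: vecs_def)

definition unit_vec :: "nat \<times> nat \<Rightarrow> nat \<times> nat \<Rightarrow> complex" where
  "unit_vec f = (\<lambda>e. if e = f then 1 else 0)"

lemma unit_vec_in_vecs: "f \<in> edges n \<Longrightarrow> unit_vec f \<in> vecs n"
  by (auto simp: unit_vec_def vecs_def)

lemma mat_apply_unit_vec: "e \<in> edges n \<Longrightarrow> f \<in> edges n \<Longrightarrow> mat_apply n A (unit_vec f) e = A e f"
  by (simp add: mat_apply_def unit_vec_def if_distrib finite_edges cong: if_cong)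

lemma vecs_induct:
  assumes "w \<in> vecs n" and zero: "P (\<lambda>_. 0)" and unit: "\<And>f. f \<in> edges n \<Longrightarrow> P (unit_vec f)"
    and lin: "\<And>a b x y. P x \<Longrightarrow> P y \<Longrightarrow> P (\<lambda>e. a * x e + b * y e)"
  shows "P w"
proof -
  have "P (\<lambda>e. if e \<in> S then w e else 0)" if "S \<subseteq> edges n" for S
    using finite_subset[OF that finite_edges] that
  proof (induction S rule: finite_induct)
    case empty
    then show ?case using zero by simp
  next
    case (insert f S)
    then have "P (\<lambda>e. 1 * (if e \<in> S then w e else 0) + w f * unit_vec f e)"
      by (intro lin unit) auto
    moreover have "(\<lambda>e. 1 * (if e \<in> S then w e else 0) + w f * unit_vec f e) =
      (\<lambda>e. if e \<in> insert f S then w e else 0)"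
      using insert.hyps by (auto simp: unit_vec_def fun_eq_iff)
    ultimately show ?case by simp
  qed
  from this[of "edges n"] have "P (\<lambda>e. if e \<in> edges n then w e else 0)" by simp
  moreover have "(\<lambda>e. if e \<in> edges n then w e else 0) = w"
    using assms(1) by (auto simp: vecs_def fun_eq_iff)
  ultimately show ?thesis by simp
qed

definition spoke :: "nat \<Rightarrow> nat \<Rightarrow> (nat \<Rightarrow> complex) \<Rightarrow> nat \<times> nat \<Rightarrow> complex" where
  "spoke n z \<epsilon> = (\<lambda>(i, j). if (i, j) \<in> edges n then (if i = z then \<epsilon> j else if j = z then \<epsilon> i else 0) else 0)"

lemma spoke_in_vecs: "spoke n z \<epsilon> \<in> vecs n"
  by (auto simp: spoke_def vecs_def)

lemma spoke_edge: "z < n \<Longrightarrow> k < n \<Longrightarrow> k \<noteq> z \<Longrightarrow> spoke n z \<epsilon> (edge z k) = \<epsilon> k"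
  by (auto simp: spoke_def edge_def edges_def min_def max_def)

lemma spoke_off: "i \<noteq> z \<Longrightarrow> j \<noteq> z \<Longrightarrow> spoke n z \<epsilon> (i, j) = 0"
  by (simp add: spoke_def)

lemma star_spoke: "z < n \<Longrightarrow> (\<And>k. \<epsilon> k \<in> {1, -1}) \<Longrightarrow> star n z (spoke n z \<epsilon>)"
proof -
  assume z: "z < n" and \<epsilon>: "\<And>k. \<epsilon> k \<in> {1, -1}"
  have "(\<epsilon> k)^2 = 1" for k using \<epsilon>[of k] by auto
  then show ?thesis
    using z by (auto simp: star_def spoke_in_vecs spoke_edge spoke_off intro!: exI[of _ 1])
qed

lemma star_in_vecs: "star n z v \<Longrightarrow> v \<in> vecs n"
  by (simp add: star_def)

lemma star_center_less: "star n z v \<Longrightarrow> z < n"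
  by (simp add: star_def)

lemma star_off: "star n z v \<Longrightarrow> i \<noteq> z \<Longrightarrow> j \<noteq> z \<Longrightarrow> v (edge i j) = 0"
  by (auto simp: star_def edge_def min_def max_def)

lemma star_on: "star n z v \<Longrightarrow> k < n \<Longrightarrow> k \<noteq> z \<Longrightarrow> v (edge z k) \<noteq> 0"
  by (auto simp: star_def)

lemma star_squares:
  assumes "star n z v" "j < n" "j \<noteq> z" "k < n" "k \<noteq> z"
  shows "(v (edge z j))^2 = (v (edge z k))^2"
proof -
  obtain c where "\<forall>j<n. j \<noteq> z \<longrightarrow> (v (edge z j))^2 = c" using assms(1) unfolding star_def by blast
  then show ?thesis using assms by metis
qed

lemma star_scale: "star n z v \<Longrightarrow> c \<noteq> 0 \<Longrightarrow> star n z (\<lambda>e. c * v e)"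
proof -
  assume st: "star n z v" and c: "c \<noteq> 0"
  obtain q where q: "q \<noteq> 0" "\<forall>j<n. j \<noteq> z \<longrightarrow> (v (edge z j))^2 = q" using st unfolding star_def by blast
  then have "c^2 * q \<noteq> 0" "\<forall>j<n. j \<noteq> z \<longrightarrow> (c * v (edge z j))^2 = c^2 * q"
    using c by (auto simp: power_mult_distrib)
  then have "\<exists>q. q \<noteq> 0 \<and> (\<forall>j<n. j \<noteq> z \<longrightarrow> (c * v (edge z j))^2 = q)" by blast
  moreover have "(\<lambda>e. c * v e) \<in> vecs n" "z < n" "\<forall>i j. i \<noteq> z \<longrightarrow> j \<noteq> z \<longrightarrow> c * v (i, j) = 0"
    using st by (simp_all add: star_def vecs_def)
  ultimately show ?thesis unfolding star_def by blast
qed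

lemma vecs_eqI:
  assumes "v \<in> vecs n" "w \<in> vecs n" "\<And>i j. i < n \<Longrightarrow> j < n \<Longrightarrow> i \<noteq> j \<Longrightarrow> v (edge i j) = w (edge i j)"
  shows "v = w"
proof
  fix e show "v e = w e"
  proof (cases "e \<in> edges n")
    case True
    then obtain i j where "e = (i, j)" "i < j" "j < n" by (rule edgesE)
    then show ?thesis using assms(3)[of i j] by (simp add: edge_def)
  next
    case False
    then show ?thesis using vecsD[OF assms(1)] vecsD[OF assms(2)] by simp
  qed
qed

lemma spoke_edge_off: "i \<noteq> z \<Longrightarrow> j \<noteq> z \<Longrightarrow> spoke n z \<epsilon> (edge i j) = 0"
  by (simp add: edge_def min_def max_def spoke_off)

lemma star_eq_spoke:
  assumes "star n z v"
  obtains c \<epsilon> where "c \<noteq> 0" "\<And>k. \<epsilon> k \<in> {1, -1}" "v = (\<lambda>e. c * spoke n z \<epsilon> e)"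
proof -
  obtain q where q: "q \<noteq> 0" "\<And>j. j < n \<Longrightarrow> j \<noteq> z \<Longrightarrow> (v (edge z j))^2 = q"
    using assms unfolding star_def by blast
  let ?c = "csqrt q" and ?\<epsilon> = "\<lambda>k. if k < n \<and> k \<noteq> z then v (edge z k) / csqrt q else 1"
  have "?\<epsilon> k \<in> {1, -1}" for k
  proof -
    have "(?\<epsilon> k)^2 = 1" using q by (auto simp: power_divide)
    then show ?thesis by (simp add: power2_eq_1_iff)
  qed
  moreover have "v = (\<lambda>e. ?c * spoke n z ?\<epsilon> e)"
  proof (rule vecs_eqI[OF star_in_vecs[OF assms]])
    show "(\<lambda>e. ?c * spoke n z ?\<epsilon> e) \<in> vecs n" using spoke_in_vecs[of n z ?\<epsilon>] by (simp add: vecs_def)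
    fix i j assume "i < n" "j < n" "i \<noteq> j"
    then show "v (edge i j) = ?c * spoke n z ?\<epsilon> (edge i j)"
      using q(1) star_off[OF assms, of i j] star_center_less[OF assms]
      by (cases "i = z"; cases "j = z") (auto simp: spoke_edge spoke_edge_off edge_commute[of i z])
  qed
  ultimately show thesis using q(1) that[of ?c ?\<epsilon>] by simp
qed

lemma star_center_unique:
  assumes "star n a v" "star n b v" "n \<ge> 3"
  shows "a = b"
proof (rule ccontr)
  assume ab: "a \<noteq> b"
  have "card {a, b} < n" using assms(3) by (simp add: card_insert_if)
  then obtain k where "k < n" "k \<notin> {a, b}" by (rule obtain_new_vertex[rotated]) auto
  then show False using star_on[OF assms(1), of k] star_off[OF assms(2), of a k] ab by auto
qed

text \<open>Flipping one sign changes the star by a multiple of a coordinate vector. This is the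
  passage from stars back to single edges.\<close>

lemma spoke_flip:
  assumes "z < n" "k < n" "k \<noteq> z"
  shows "spoke n z \<epsilon> = (\<lambda>e. 1 * spoke n z (\<epsilon>(k := - \<epsilon> k)) e + 2 * \<epsilon> k * unit_vec (edge z k) e)"
proof (rule vecs_eqI[OF spoke_in_vecs])
  show "(\<lambda>e. 1 * spoke n z (\<epsilon>(k := - \<epsilon> k)) e + 2 * \<epsilon> k * unit_vec (edge z k) e) \<in> vecs n"
    using assms by (intro vecs_linear spoke_in_vecs unit_vec_in_vecs edge_in_edges) auto
  fix i j assume "i < n" "j < n" "i \<noteq> j"
  then show "spoke n z \<epsilon> (edge i j) =
    1 * spoke n z (\<epsilon>(k := - \<epsilon> k)) (edge i j) + 2 * \<epsilon> k * unit_vec (edge z k) (edge i j)"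
    using assms by (cases "i = z"; cases "j = z")
      (auto simp: spoke_edge spoke_edge_off edge_commute[of i z] unit_vec_def edge_eq_iff)
qed

lemma sqd_edge:
  assumes "i < n" "j < n" "i \<noteq> j"
  shows "sqd n u (edge i j) = (u i - u j)^2"
proof (cases "i < j")
  case True
  then show ?thesis using assms by (simp add: sqd_def edge_def edges_def)
next
  case False
  then show ?thesis using assms by (simp add: sqd_def edge_def edges_def power2_commute[of "u j"])
qed

lemma sqd_in_unsq_variety:
  assumes "v \<in> vecs n" "(\<lambda>e. (v e)^2) = sqd n u" "d \<ge> 1"
  shows "v \<in> unsq_meas_variety d n"
  using assms sum_list_sqd_in_variety[of "[sqd n u]" n d] by (simp add: unsq_meas_variety_def)

text \<open>Stars with different centers \<open>a\<close>, \<open>b\<close> come from collinear configurations with all points other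
  than \<open>p\<^sub>a\<close>, \<open>p\<^sub>b\<close> at the origin, and so do their linear combinations.\<close>

lemma stars_span_in_variety:
  assumes v: "star n a v" and w: "star n b w" and ab: "a \<noteq> b" and d: "d \<ge> 1"
  shows "(\<lambda>e. 1 * v e + t * w e) \<in> unsq_meas_variety d n"
proof (rule sqd_in_unsq_variety[OF vecs_linear[OF star_in_vecs[OF v] star_in_vecs[OF w]] _ d])
  \<comment> \<open>The positions are chosen so that the difference between \<open>a\<close> and
    \<open>b\<close> is the value of \<open>v + t w\<close> on their common edge.\<close>
  let ?u = "\<lambda>k. if k = a then v (edge a b) else if k = b then - t * w (edge a b) else 0"
  have vw: "(v (edge a k))^2 = (v (edge a b))^2" "(w (edge b k'))^2 = (w (edge a b))^2"
    if "k < n" "k \<noteq> a" "k' < n" "k' \<noteq> b" for k k'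
  proof -
    have "b < n" "a < n" using v w by (auto dest: star_center_less)
    then show "(v (edge a k))^2 = (v (edge a b))^2" "(w (edge b k'))^2 = (w (edge a b))^2"
      using star_squares[OF v, of k b] star_squares[OF w, of k' a] that ab
      unfolding edge_commute[of b a] by blast+
  qed
  have off: "v (edge i j) = 0" if "i \<noteq> a" "j \<noteq> a" for i j using star_off[OF v that] .
  have off': "w (edge i j) = 0" if "i \<noteq> b" "j \<noteq> b" for i j using star_off[OF w that] .
  show "(\<lambda>e. (1 * v e + t * w e)^2) = sqd n ?u"
  proof (rule vecs_eqI)
    show "(\<lambda>e. (1 * v e + t * w e)^2) \<in> vecs n"
      using star_in_vecs[OF v] star_in_vecs[OF w] by (simp add: vecs_def)
    show "sqd n ?u \<in> vecs n" by (rule sqd_in_vecs)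
    fix i j assume ij: "i < n" "j < n" "i \<noteq> j"
    have sqd: "sqd n ?u (edge i j) = (?u i - ?u j)^2"
      by (rule sqd_edge[OF ij])
    have lone: "(1 * v (edge a j) + t * w (edge a j))^2 = (v (edge a b))^2" if "j < n" "j \<noteq> a" "j \<noteq> b" for j
      using vw(1)[of j a] off'[of a j] that ab star_center_less[OF v] by simp
    have lone': "(1 * v (edge b j) + t * w (edge b j))^2 = (t * w (edge a b))^2" if "j < n" "j \<noteq> a" "j \<noteq> b" for j
      using vw(2)[of b j] off[of b j] that ab star_center_less[OF w] by (simp add: power_mult_distrib)
    have main: "(1 * v (edge i j) + t * w (edge i j))^2 = (?u i - ?u j)^2"
      if "j < n" "i \<noteq> j" and cases: "i = a \<or> i = b \<and> j \<noteq> a \<or> i \<notin> {a, b} \<and> j \<notin> {a, b}" for i j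
    proof -
      consider "i = a" "j = b" | "i = a" "j \<noteq> b" | "i = b" "j \<noteq> a" | "i \<notin> {a, b}" "j \<notin> {a, b}"
        using cases by blast
      then show ?thesis
      proof cases
        case 1
        then show ?thesis using ab by simp
      next
        case 2
        then show ?thesis using lone[of j] that by simp
      next
        case 3
        then show ?thesis using lone'[of j] that ab by simp
      next
        case 4
        then show ?thesis using off[of i j] off'[of i j] by simp
      qed
    qed
    show "(1 * v (edge i j) + t * w (edge i j))^2 = sqd n ?u (edge i j)"
    proof (cases "i = a \<or> i = b \<and> j \<noteq> a \<or> i \<notin> {a, b} \<and> j \<notin> {a, b}")
      case True
      then show ?thesis unfolding sqd using main[OF ij(2,3)] by blast
    next
      case False
      have "(1 * v (edge j i) + t * w (edge j i))^2 = (?u j - ?u i)^2"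
        by (rule main) (use ij False in auto)
      then show ?thesis
        unfolding sqd using power2_commute[of "?u i" "?u j"] by (simp only: edge_commute[of j i])
    qed
  qed
qed

lemma star_in_variety: "star n z v \<Longrightarrow> d \<ge> 1 \<Longrightarrow> n \<ge> 2 \<Longrightarrow> v \<in> unsq_meas_variety d n"
proof -
  assume v: "star n z v" and d: "d \<ge> 1" and n: "n \<ge> 2"
  obtain b where b: "b < n" "b \<notin> {z}" by (rule obtain_new_vertex[of "{z}" n]) (use n in auto)
  have "(\<lambda>e. 1 * v e + 0 * spoke n b (\<lambda>_. 1) e) \<in> unsq_meas_variety d n"
    using b by (intro stars_span_in_variety[OF v star_spoke _ d]) auto
  then show ?thesis by simp
qed

lemma variety_in_vecs: "l \<in> unsq_meas_variety d n \<Longrightarrow> l \<in> vecs n"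
  by (simp add: unsq_meas_variety_def)


section \<open>The linear map of an automorphism\<close>

lemma mat_apply_zero: "mat_apply n A (\<lambda>_. 0) = (\<lambda>_. 0)"
  by (simp add: mat_apply_def fun_eq_iff)

lemma mat_apply_scale: "mat_apply n A (\<lambda>e. c * v e) = (\<lambda>e. c * mat_apply n A v e)"
  using mat_apply_linear[of n A c v 0 v] by simp

lemma linear_automorphism_injective:
  assumes "linear_automorphism n V A" "x \<in> vecs n" "y \<in> vecs n" "mat_apply n A x = mat_apply n A y"
  shows "x = y"
proof -
  have "mat_apply n A (\<lambda>e. 1 * x e + (-1) * y e) = (\<lambda>_. 0)"
    unfolding mat_apply_linear assms(4) by simp
  moreover have "(\<lambda>e. 1 * x e + (-1) * y e) \<in> vecs n" by (intro vecs_linear assms)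
  ultimately have "(\<lambda>e. 1 * x e + (-1) * y e) = (\<lambda>_. 0)"
    using assms(1) unfolding linear_automorphism_def nonsingular_def by blast
  then show ?thesis by (simp add: fun_eq_iff)
qed

text \<open>As a locale, the construction of centers can be instantiated for the inverse matrix as
  well.\<close>

locale variety_automorphism =
  fixes d n :: nat and A :: "nat \<times> nat \<Rightarrow> nat \<times> nat \<Rightarrow> complex"
  assumes d: "d \<ge> 1" and n: "n \<ge> d + 2" and dn: "(d, n) \<noteq> (2, 4)"
    and aut: "linear_automorphism n (unsq_meas_variety d n) A"
begin

abbreviation "L \<equiv> unsq_meas_variety d n"
abbreviation "M \<equiv> mat_apply n A"

lemma n3: "n \<ge> 3"
  using d n by simp

lemma bij: "bij_betw M L L"
  using aut unfolding linear_automorphism_def by blast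

lemma M_in_L: "l \<in> L \<Longrightarrow> M l \<in> L"
  using bij bij_betwE by blast

lemma in_L_if_M_in_L:
  assumes "x \<in> vecs n" "M x \<in> L"
  shows "x \<in> L"
proof -
  have "M x \<in> M ` L" using assms(2) bij_betw_imp_surj_on[OF bij] by simp
  then obtain l where l: "l \<in> L" "M l = M x" by (metis imageE)
  have "l = x"
    using variety_in_vecs[OF l(1)] assms(1) l(2) by (rule linear_automorphism_injective[OF aut])
  then show ?thesis using l(1) by simp
qed

text \<open>The variety lies in the image because it is mapped onto itself. It contains the stars,
  and coordinate vectors are half differences of two stars.\<close>

lemma M_surj:
  assumes "w \<in> vecs n"
  shows "\<exists>u\<in>vecs n. M u = w"
  using assms
proof (rule vecs_induct)
  show "\<exists>u\<in>vecs n. M u = (\<lambda>_. 0)"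
    by (rule bexI[of _ "\<lambda>_. 0"]) (simp_all add: mat_apply_zero vecs_def)
  have lin: "\<exists>u\<in>vecs n. M u = (\<lambda>e. a * x e + b * y e)"
    if xy: "\<exists>u\<in>vecs n. M u = x" "\<exists>u\<in>vecs n. M u = y" for a b x y
  proof -
    obtain u u' where "u \<in> vecs n" "M u = x" "u' \<in> vecs n" "M u' = y" using xy by blast
    then show ?thesis
      by (intro bexI[of _ "\<lambda>e. a * u e + b * u' e"]) (simp_all only: mat_apply_linear vecs_linear)
  qed
  then show "\<And>a b x y. \<exists>u\<in>vecs n. M u = x \<Longrightarrow> \<exists>u\<in>vecs n. M u = y \<Longrightarrow>
    \<exists>u\<in>vecs n. M u = (\<lambda>e. a * x e + b * y e)" .
  have inL: "\<exists>u\<in>vecs n. M u = l" if "l \<in> L" for l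
  proof -
    have "l \<in> M ` L" using that bij_betw_imp_surj_on[OF bij] by simp
    then show ?thesis using variety_in_vecs by blast
  qed
  fix f assume "f \<in> edges n"
  then obtain i j where f: "f = (i, j)" "i < j" "j < n" by (rule edgesE)
  let ?\<epsilon> = "\<lambda>_. 1 :: complex"
  have edge: "edge i j = f" using f by (simp add: edge_def)
  have "star n i (spoke n i ?\<epsilon>)" "star n i (spoke n i (?\<epsilon>(j := - ?\<epsilon> j)))"
    using f by (auto intro!: star_spoke split: if_splits)
  then have "\<exists>u\<in>vecs n. M u = (\<lambda>e. 1/2 * spoke n i ?\<epsilon> e + (- 1/2) * spoke n i (?\<epsilon>(j := - ?\<epsilon> j)) e)"
    using d n by (intro lin inL star_in_variety) auto
  moreover have "(\<lambda>e. 1/2 * spoke n i ?\<epsilon> e + (- 1/2) * spoke n i (?\<epsilon>(j := - ?\<epsilon> j)) e) = unit_vec f"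
  proof
    fix e
    have "spoke n i ?\<epsilon> e = 1 * spoke n i (?\<epsilon>(j := - ?\<epsilon> j)) e + 2 * 1 * unit_vec (edge i j) e"
      by (rule fun_cong[OF spoke_flip]) (use f in auto)
    then show "1/2 * spoke n i ?\<epsilon> e + (- 1/2) * spoke n i (?\<epsilon>(j := - ?\<epsilon> j)) e = unit_vec f e"
      by (simp add: edge add_divide_distrib)
  qed
  ultimately show "\<exists>u\<in>vecs n. M u = unit_vec f" by simp
qed

text \<open>Pulling a vanishing polynomial back along \<open>M\<close> gives another one of the same
  degree, so the degree bound along \<open>v\<close> becomes one along \<open>M v\<close>.
  Surjectivity reaches every base point.\<close>

lemma star_image:
  assumes v: "star n z v"
  shows "\<exists>z'. star n z' (M v)"
proof (rule low_degree_star[OF d n _ mat_apply_in_vecs])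
  show "low_degree d n (M v)"
    unfolding low_degree_def
  proof (intro allI impI ballI)
    fix F w assume F: "hom_poly (edges n) (2 * d + 2) F" "\<forall>l\<in>L. F l = 0" and "w \<in> vecs n"
    then obtain u where u: "u \<in> vecs n" "M u = w" using M_surj by blast
    have "hom_poly (edges n) (2 * d + 2) (\<lambda>l. F (M l))"
      by (rule hom_poly_compose_linear[OF _ F(1)]) (simp add: mat_apply_def)
    then have "deg_le 2 (\<lambda>s. F (M (\<lambda>e. u e + s * v e)))"
      using F(2) M_in_L by (intro star_deg_le_2[OF d _ _ v u(1)]) auto
    moreover have "M (\<lambda>e. u e + s * v e) = (\<lambda>e. w e + s * M v e)" for s
      using mat_apply_linear[of n A 1 u s v] u by simp
    ultimately show "deg_le 2 (\<lambda>s. F (\<lambda>e. w e + s * M v e))" by simp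
  qed
  show "M v \<noteq> (\<lambda>_. 0)"
  proof
    assume "M v = (\<lambda>_. 0)"
    then have "v = (\<lambda>_. 0)"
      using aut star_in_vecs[OF v] unfolding linear_automorphism_def nonsingular_def by blast
    moreover obtain k where "k < n" "k \<notin> {z}" by (rule obtain_new_vertex[of "{z}" n]) (use n in auto)
    ultimately show False using star_on[OF v, of k] by simp
  qed
qed

text \<open>The columns of \<open>B\<close> are preimages of the coordinate vectors.\<close>

lemma inverse:
  obtains B where "variety_automorphism d n B" "\<And>v. v \<in> vecs n \<Longrightarrow> mat_apply n B (M v) = v"
proof -
  have "\<forall>f\<in>edges n. \<exists>u\<in>vecs n. M u = unit_vec f" using M_surj unit_vec_in_vecs by blast
  then obtain U where U: "\<And>f. f \<in> edges n \<Longrightarrow> U f \<in> vecs n" "\<And>f. f \<in> edges n \<Longrightarrow> M (U f) = unit_vec f"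
    by metis
  define B where "B e f = U f e" for e f
  let ?B = "mat_apply n B"
  have B_unit: "?B (unit_vec f) = U f" if "f \<in> edges n" for f
  proof
    fix e show "?B (unit_vec f) e = U f e"
    proof (cases "e \<in> edges n")
      case True
      then show ?thesis using that by (simp add: mat_apply_unit_vec B_def)
    next
      case False
      then show ?thesis using vecsD[OF U(1)[OF that]] vecsD[OF mat_apply_in_vecs] by simp
    qed
  qed
  have MB: "M (?B w) = w" if "w \<in> vecs n" for w
    using that
  proof (rule vecs_induct)
    show "M (?B (unit_vec f)) = unit_vec f" if "f \<in> edges n" for f
      using that by (simp add: B_unit U)
  qed (simp_all add: mat_apply_zero mat_apply_linear)
  have BM: "?B (M v) = v" if "v \<in> vecs n" for v
    by (rule linear_automorphism_injective[OF aut]) (simp_all add: that mat_apply_in_vecs MB)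
  have LB: "?B l \<in> L" if "l \<in> L" for l
  proof (rule in_L_if_M_in_L[OF mat_apply_in_vecs])
    show "M (?B l) \<in> L" unfolding MB[OF variety_in_vecs[OF that]] by (rule that)
  qed
  have "linear_automorphism n L B"
    unfolding linear_automorphism_def
  proof
    show "nonsingular n B"
      unfolding nonsingular_def using MB mat_apply_zero by metis
    show "bij_betw ?B L L"
      by (rule bij_betw_byWitness[where f' = M])
        (use M_in_L LB in \<open>auto simp: MB BM variety_in_vecs\<close>)
  qed
  then have "variety_automorphism d n B" using d n dn by unfold_locales
  then show thesis using BM by (rule that)
qed

text \<open>On the edge from \<open>a\<close> to a vertex that is none of the four centers, only
  stars centered at \<open>a\<close> are non-zero; hence \<open>a\<close> occurs on the right, and
  likewise \<open>b\<close>.\<close>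

lemma star_relation:
  assumes n5: "n \<ge> 5" and st: "star n a x1" "star n b x2" "star n y x3" "star n y' x4"
    and rel: "\<And>e. x1 e - x2 e = x3 e - x4 e" and ab: "a \<noteq> b"
  shows "y = a \<and> y' = b \<or> y = b \<and> y' = a"
proof -
  have "card {a, b, y, y'} < n" using n5 by (simp add: card_insert_if)
  then obtain k where k: "k < n" "k \<notin> {a, b, y, y'}" by (rule obtain_new_vertex[rotated]) auto
  have "a \<in> {y, y'}"
  proof (rule ccontr)
    assume "a \<notin> {y, y'}"
    then show False
      using star_on[OF st(1), of k] star_off[OF st(2), of a k] star_off[OF st(3), of a k]
        star_off[OF st(4), of a k] rel[of "edge a k"] k ab by auto
  qed
  moreover have "b \<in> {y, y'}"
  proof (rule ccontr)
    assume "b \<notin> {y, y'}"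
    then show False
      using star_on[OF st(2), of k] star_off[OF st(1), of b k] star_off[OF st(3), of b k]
        star_off[OF st(4), of b k] rel[of "edge b k"] k ab by auto
  qed
  ultimately show ?thesis using ab by auto
qed

lemma supported_on_common_edge:
  assumes "x \<in> vecs n" "a < n" "b < n" "a \<noteq> b"
    and "\<And>i j. i \<noteq> a \<Longrightarrow> j \<noteq> a \<Longrightarrow> x (edge i j) = 0" "\<And>i j. i \<noteq> b \<Longrightarrow> j \<noteq> b \<Longrightarrow> x (edge i j) = 0"
  shows "x = (\<lambda>e. x (edge a b) * unit_vec (edge a b) e)"
proof (rule vecs_eqI[OF assms(1)])
  show "(\<lambda>e. x (edge a b) * unit_vec (edge a b) e) \<in> vecs n"
    using unit_vec_in_vecs[OF edge_in_edges[OF assms(2,3,4)]] by (simp add: vecs_def)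
  fix i j assume "i < n" "j < n" "i \<noteq> j"
  show "x (edge i j) = x (edge a b) * unit_vec (edge a b) (edge i j)"
  proof (cases "edge i j = edge a b")
    case False
    then have "(i \<noteq> a \<and> j \<noteq> a) \<or> (i \<noteq> b \<and> j \<noteq> b)" using assms(4) \<open>i \<noteq> j\<close> by (auto simp: edge_eq_iff)
    then have "x (edge i j) = 0" using assms(5,6) by blast
    then show ?thesis using False by (simp add: unit_vec_def)
  qed (simp add: unit_vec_def)
qed

text \<open>If flipping the sign at \<open>j\<close> moved the center from \<open>a\<close> to
  \<open>b\<close>, then for every third vertex \<open>k\<close> some combination of spokes would be
  mapped into the line of the edge \<open>ab\<close>. By injectivity these combinations are
  proportional, but their supports differ.\<close>

lemma flip_preserves_center:
  assumes n5: "n \<ge> 5" and z: "z < n" "j < n" "j \<noteq> z" and \<epsilon>: "\<And>k. \<epsilon> k \<in> {1, -1}"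
    and a: "star n a (M (spoke n z \<epsilon>))" and b: "star n b (M (spoke n z (\<epsilon>(j := - \<epsilon> j))))"
  shows "a = b"
proof (rule ccontr)
  assume ab: "a \<noteq> b"
  have lt: "a < n" "b < n" using a b by (auto dest: star_center_less)
  let ?u = "unit_vec (edge a b)"
  \<comment> \<open>The two possible supports of such combinations on the edges from
    \<open>z\<close> to vertices other than \<open>j\<close>: only \<open>k\<close>, or all but
    \<open>k\<close>.\<close>
  define isol where "isol k c \<longleftrightarrow> (\<forall>i<n. i \<noteq> z \<longrightarrow> i \<noteq> j \<longrightarrow> (c (edge z i) \<noteq> 0 \<longleftrightarrow> i = k))"
    for k and c :: "nat \<times> nat \<Rightarrow> complex"
  define coisol where "coisol k c \<longleftrightarrow> (\<forall>i<n. i \<noteq> z \<longrightarrow> i \<noteq> j \<longrightarrow> (c (edge z i) \<noteq> 0 \<longleftrightarrow> i \<noteq> k))"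
    for k and c :: "nat \<times> nat \<Rightarrow> complex"
  have nz: "\<epsilon> k \<noteq> 0" for k using \<epsilon>[of k] by auto
  have key: "\<exists>c \<kappa>. c \<in> vecs n \<and> M c = (\<lambda>e. \<kappa> * ?u e) \<and> (isol k c \<or> coisol k c)"
    if k: "k < n" "k \<noteq> z" "k \<noteq> j" for k
  proof -
    let ?v = "spoke n z \<epsilon>" and ?vj = "spoke n z (\<epsilon>(j := - \<epsilon> j))"
    let ?vk = "spoke n z (\<epsilon>(k := - \<epsilon> k))" and ?vjk = "spoke n z (\<epsilon>(k := - \<epsilon> k, j := - \<epsilon> j))"
    have sign: "(\<epsilon>(k := - \<epsilon> k)) i \<in> {1, -1}" "(\<epsilon>(k := - \<epsilon> k, j := - \<epsilon> j)) i \<in> {1, -1}" for i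
      using \<epsilon>[of i] by auto
    have "star n z ?vk" "star n z ?vjk"
      by (rule star_spoke[OF z(1) sign(1)], rule star_spoke[OF z(1) sign(2)])
    then obtain y y' where y: "star n y (M ?vk)" and y': "star n y' (M ?vjk)"
      using star_image by blast
    have "?v = (\<lambda>e. 1 * ?vj e + 2 * \<epsilon> j * unit_vec (edge z j) e)"
      by (rule spoke_flip[OF z])
    then have Mv: "M ?v = (\<lambda>e. 1 * M ?vj e + 2 * \<epsilon> j * M (unit_vec (edge z j)) e)"
      by (simp only: mat_apply_linear)
    have "?vk = (\<lambda>e. 1 * ?vjk e + 2 * \<epsilon> j * unit_vec (edge z j) e)"
      using spoke_flip[OF z, of "\<epsilon>(k := - \<epsilon> k)"] k(3) by (simp only: fun_upd_other not_sym)
    then have Mvk: "M ?vk = (\<lambda>e. 1 * M ?vjk e + 2 * \<epsilon> j * M (unit_vec (edge z j)) e)"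
      by (simp only: mat_apply_linear)
    have rel: "M ?v e - M ?vj e = M ?vk e - M ?vjk e" for e
      unfolding Mv Mvk by simp
    from star_relation[OF n5 a b y y' rel ab]
    consider "star n a (M ?vk)" "star n b (M ?vjk)" | "star n b (M ?vk)" "star n a (M ?vjk)"
      using y y' by blast
    then show ?thesis
    proof cases
      case 1
      \<comment> \<open>By \<open>rel\<close> the image of this difference is also that of
        \<open>?vj\<close> and \<open>?vjk\<close>, so it lives on the edges at \<open>a\<close> and
        on those at \<open>b\<close>.\<close>
      let ?c = "\<lambda>e. 1 * ?v e + (-1) * ?vk e"
      have "M ?c = (\<lambda>e. M ?c (edge a b) * ?u e)"
      proof (rule supported_on_common_edge[OF mat_apply_in_vecs lt ab])
        show "M ?c (edge i h) = 0" if "i \<noteq> a" "h \<noteq> a" for i h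
          unfolding mat_apply_linear using star_off[OF a that] star_off[OF 1(1) that] by simp
        show "M ?c (edge i h) = 0" if "i \<noteq> b" "h \<noteq> b" for i h
          unfolding mat_apply_linear
          using star_off[OF b that] star_off[OF 1(2) that] rel[of "edge i h"] by simp
      qed
      moreover have "isol k ?c"
        using z nz by (auto simp: isol_def spoke_edge)
      ultimately show ?thesis using vecs_linear[OF spoke_in_vecs spoke_in_vecs] by blast
    next
      case 2
      \<comment> \<open>Now the sum works: by \<open>rel\<close> its image equals that of
        \<open>?vj\<close> plus \<open>?vk\<close>, which are both centered at
        \<open>b\<close>.\<close>
      let ?c = "\<lambda>e. 1 * ?v e + 1 * ?vjk e"
      have "M ?c = (\<lambda>e. M ?c (edge a b) * ?u e)"
      proof (rule supported_on_common_edge[OF mat_apply_in_vecs lt ab])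
        show "M ?c (edge i h) = 0" if "i \<noteq> a" "h \<noteq> a" for i h
          unfolding mat_apply_linear using star_off[OF a that] star_off[OF 2(2) that] by simp
        show "M ?c (edge i h) = 0" if "i \<noteq> b" "h \<noteq> b" for i h
          unfolding mat_apply_linear
          using star_off[OF b that] star_off[OF 2(1) that] rel[of "edge i h"] by simp
      qed
      moreover have "coisol k ?c"
        using z nz by (auto simp: coisol_def spoke_edge)
      ultimately show ?thesis using vecs_linear[OF spoke_in_vecs spoke_in_vecs] by blast
    qed
  qed
  have "card {z, j} < n" using n5 by (simp add: card_insert_if)
  then obtain k1 where k1: "k1 < n" "k1 \<notin> {z, j}" by (rule obtain_new_vertex[rotated]) auto
  have "card {z, j, k1} < n" using n5 by (simp add: card_insert_if)
  then obtain k2 where k2: "k2 < n" "k2 \<notin> {z, j, k1}" by (rule obtain_new_vertex[rotated]) auto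
  \<comment> \<open>The fifth vertex \<open>k3\<close> is what separates "only \<open>k1\<close>"
    from "all but \<open>k2\<close>"; those supports agree on \<open>k1\<close> and
    \<open>k2\<close>.\<close>
  have "card {z, j, k1, k2} < n" using n5 by (simp add: card_insert_if)
  then obtain k3 where k3: "k3 < n" "k3 \<notin> {z, j, k1, k2}" by (rule obtain_new_vertex[rotated]) auto
  obtain c1 \<kappa>1 where c1: "c1 \<in> vecs n" "M c1 = (\<lambda>e. \<kappa>1 * ?u e)" "isol k1 c1 \<or> coisol k1 c1"
    using key[of k1] k1 by auto
  obtain c2 \<kappa>2 where c2: "c2 \<in> vecs n" "M c2 = (\<lambda>e. \<kappa>2 * ?u e)" "isol k2 c2 \<or> coisol k2 c2"
    using key[of k2] k2 by auto
  have nonzero: "c \<noteq> 0" if "isol k c \<or> coisol k c" "k \<in> {k1, k2}" for k c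
    using that k1 k2 k3 unfolding isol_def coisol_def by (metis insertCI insertE singletonD zero_fun_apply)
  have \<kappa>: "\<kappa> \<noteq> 0" if "c \<in> vecs n" "M c = (\<lambda>e. \<kappa> * ?u e)" "c \<noteq> 0" for c \<kappa>
  proof
    assume "\<kappa> = 0"
    then have "c = (\<lambda>_. 0)"
      using aut that(1,2) unfolding linear_automorphism_def nonsingular_def by simp
    then show False using that(3) by (simp add: fun_eq_iff)
  qed
  have "\<kappa>1 \<noteq> 0" "\<kappa>2 \<noteq> 0" using \<kappa> c1 c2 nonzero by auto
  have "(\<lambda>e. \<kappa>2 * c1 e) = (\<lambda>e. \<kappa>1 * c2 e)"
    by (rule linear_automorphism_injective[OF aut])
      (use c1 c2 in \<open>simp_all add: mat_apply_scale mult_ac vecs_def\<close>)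
  then have "\<kappa>2 * c1 e = \<kappa>1 * c2 e" for e by (rule fun_cong)
  then have "c1 e \<noteq> 0 \<longleftrightarrow> c2 e \<noteq> 0" for e
    using \<open>\<kappa>1 \<noteq> 0\<close> \<open>\<kappa>2 \<noteq> 0\<close> by (metis mult_eq_0_iff)
  then show False
    using c1(3) c2(3) k1 k2 k3 unfolding isol_def coisol_def by auto
qed

text \<open>Any sign vector is reached from the constant one by flipping signs one at a
  time.\<close>

lemma spoke_center_n5:
  assumes n5: "n \<ge> 5" and z: "z < n"
  shows "\<exists>z'. \<forall>\<epsilon>. (\<forall>k. \<epsilon> k \<in> {1, -1}) \<longrightarrow> star n z' (M (spoke n z \<epsilon>))"
proof -
  define sgn where "sgn S = (\<lambda>k. if k \<in> S then -1 else (1::complex))" for S :: "nat set"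
  have sgn: "sgn S k \<in> {1, -1}" for S k by (simp add: sgn_def)
  have star_sgn: "star n z (spoke n z (sgn S))" for S by (rule star_spoke[OF z sgn])
  obtain z' where z': "star n z' (M (spoke n z (sgn {})))"
    using star_image[OF star_sgn] by blast
  have all: "star n z' (M (spoke n z (sgn S)))" if "S \<subseteq> {..<n} - {z}" for S
    using finite_subset[OF that finite_Diff[OF finite_lessThan]] that
  proof (induction S rule: finite_induct)
    case empty
    then show ?case using z' by simp
  next
    case (insert k S)
    have eq: "(sgn S)(k := - sgn S k) = sgn (insert k S)" using insert.hyps by (auto simp: sgn_def)
    obtain b where b: "star n b (M (spoke n z (sgn (insert k S))))"
      using star_image[OF star_sgn] by blast
    have "z' = b"
      by (rule flip_preserves_center[OF n5 z, of k "sgn S"]) (use insert b sgn in \<open>auto simp: eq\<close>)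
    then show ?case using b by simp
  qed
  have "star n z' (M (spoke n z \<epsilon>))" if \<epsilon>: "\<forall>k. \<epsilon> k \<in> {1, -1}" for \<epsilon>
  proof -
    let ?S = "{k. k < n \<and> k \<noteq> z \<and> \<epsilon> k = -1}"
    have "\<epsilon> k = sgn ?S k" if "k < n" "k \<noteq> z" for k
      using \<epsilon>[rule_format, of k] that by (auto simp: sgn_def)
    then have "spoke n z \<epsilon> = spoke n z (sgn ?S)"
      by (auto simp: spoke_def fun_eq_iff edges_def)
    then show ?thesis using all[of ?S] by auto
  qed
  then show ?thesis by blast
qed

text \<open>Different centers would put the sum of the images, hence \<open>v + w\<close>, into the
  variety. On a line this makes all points other than the one at \<open>z\<close> coincide, so
  \<open>v + w\<close> has constant square at \<open>z\<close>. Then \<open>w\<close> is a multiple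
  of \<open>v\<close>, and the images share their center after all.\<close>

lemma same_center_d1:
  assumes d1: "d = 1" and v: "star n z v" and w: "star n z w"
    and a: "star n a (M v)" and b: "star n b (M w)"
  shows "a = b"
proof (rule ccontr)
  assume ab: "a \<noteq> b"
  let ?x = "\<lambda>e. 1 * v e + 1 * w e"
  have z: "z < n" by (rule star_center_less[OF v])
  have "M ?x \<in> L"
    unfolding mat_apply_linear by (rule stars_span_in_variety[OF a b ab d])
  then have "?x \<in> L"
    by (rule in_L_if_M_in_L[OF vecs_linear[OF star_in_vecs[OF v] star_in_vecs[OF w]]])
  then obtain p where p: "\<forall>i<n. \<forall>j<n. sq_len ?x i j = (\<Sum>k<d. (p i k - p j k)^2)"
    using sq_len_variety by blast
  have eq: "v (edge z j) * w (edge z j) = v (edge z k) * w (edge z k)" if jk: "j < n" "j \<noteq> z" "k < n" "k \<noteq> z" for j k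
  proof -
    have "sq_len ?x j k = 0" using star_off[OF v jk(2,4)] star_off[OF w jk(2,4)] by (simp add: sq_len_def)
    then have "p j 0 = p k 0" using p jk d1 by simp
    then have "sq_len ?x z j = sq_len ?x z k" using p jk z d1 by simp
    then have "(v (edge z j) + w (edge z j))^2 = (v (edge z k) + w (edge z k))^2"
      using jk by (simp add: sq_len_def)
    then show ?thesis using star_squares[OF v jk] star_squares[OF w jk] by algebra
  qed
  obtain k where k: "k < n" "k \<noteq> z" by (rule obtain_new_vertex[of "{z}" n]) (use n in auto)
  define r where "r = w (edge z k) / v (edge z k)"
  have nz: "v (edge z k) \<noteq> 0" "r \<noteq> 0" using star_on[OF v k] star_on[OF w k] by (auto simp: r_def)
  have wr: "w (edge z j) = r * v (edge z j)" if j: "j < n" "j \<noteq> z" for j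
  proof -
    \<comment> \<open>The extra factor \<open>v (edge z j)\<close> lets the equality of squares be
      applied; it is cancelled afterwards.\<close>
    have "v (edge z j) * (v (edge z k) * w (edge z j)) = v (edge z j) * (w (edge z k) * v (edge z j))"
      using eq[OF j k] star_squares[OF v j k] by algebra
    then have "v (edge z k) * w (edge z j) = w (edge z k) * v (edge z j)" using star_on[OF v j] by simp
    then show ?thesis using nz by (simp add: r_def field_simps)
  qed
  have "w = (\<lambda>e. r * v e)"
  proof (rule vecs_eqI[OF star_in_vecs[OF w] star_in_vecs[OF star_scale[OF v nz(2)]]])
    fix i j assume ij: "i < n" "j < n" "i \<noteq> j"
    consider "i = z" | "j = z" | "i \<noteq> z" "j \<noteq> z" by blast
    then show "w (edge i j) = r * v (edge i j)"
    proof cases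
      case 1
      then show ?thesis using wr[of j] ij by simp
    next
      case 2
      then show ?thesis using wr[of i] ij by (simp add: edge_commute[of i z])
    next
      case 3
      then show ?thesis using star_off[OF v 3] star_off[OF w 3] by simp
    qed
  qed
  then have "star n a (M w)" using star_scale[OF a nz(2)] by (simp only: mat_apply_scale)
  then show False using star_center_unique[OF _ b n3] ab by blast
qed

lemma center_exists:
  assumes z: "z < n"
  shows "\<exists>z'. \<forall>v. star n z v \<longrightarrow> star n z' (M v)"
proof -
  have "\<exists>z'. \<forall>\<epsilon>. (\<forall>k. \<epsilon> k \<in> {1, -1}) \<longrightarrow> star n z' (M (spoke n z \<epsilon>))"
  proof (cases "d = 1")
    case True
    have one: "star n z (spoke n z (\<lambda>_. 1))" using z by (rule star_spoke) simp
    then obtain z' where z': "star n z' (M (spoke n z (\<lambda>_. 1)))" using star_image by blast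
    have "star n z' (M (spoke n z \<epsilon>))" if "\<forall>k. \<epsilon> k \<in> {1, -1}" for \<epsilon>
    proof -
      have st: "star n z (spoke n z \<epsilon>)" using that by (intro star_spoke[OF z]) blast
      then obtain b where b: "star n b (M (spoke n z \<epsilon>))" using star_image by blast
      have "z' = b" by (rule same_center_d1[OF True one st z' b])
      then show ?thesis using b by simp
    qed
    then show ?thesis by blast
  next
    case False
    \<comment> \<open>The pair \<open>(2, 4)\<close> is the only one with \<open>d \<ge> 2\<close>
      and \<open>n \<ge> d + 2\<close> that has fewer than five vertices.\<close>
    then have "n \<ge> 5" using d n dn by auto
    then show ?thesis using z by (rule spoke_center_n5)
  qed
  then obtain z' where z': "\<And>\<epsilon>. (\<And>k. \<epsilon> k \<in> {1, -1}) \<Longrightarrow> star n z' (M (spoke n z \<epsilon>))" by blast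
  have "star n z' (M v)" if v: "star n z v" for v
  proof -
    obtain c \<epsilon> where c: "c \<noteq> 0" "\<And>k. \<epsilon> k \<in> {1, -1}" "v = (\<lambda>e. c * spoke n z \<epsilon> e)"
      using v by (rule star_eq_spoke) blast
    show ?thesis unfolding c(3) mat_apply_scale by (rule star_scale[OF z'[OF c(2)] c(1)])
  qed
  then show ?thesis by blast
qed

section \<open>The vertex permutation and the matrix entries\<close>

definition center :: "nat \<Rightarrow> nat" where
  "center z = (SOME z'. \<forall>v. star n z v \<longrightarrow> star n z' (M v))"

lemma star_center: "star n z v \<Longrightarrow> star n (center z) (M v)"
  using someI_ex[OF center_exists[OF star_center_less]] unfolding center_def by blast

lemma star_ones: "z < n \<Longrightarrow> star n z (spoke n z (\<lambda>_. 1))"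
  by (rule star_spoke) simp_all

lemma center_less: "z < n \<Longrightarrow> center z < n"
  using star_center_less[OF star_center[OF star_ones]] .

text \<open>The center map of the inverse automorphism is a left inverse.\<close>

lemma center_inj: "inj_on center {..<n}"
proof -
  obtain B where B: "variety_automorphism d n B" "\<And>v. v \<in> vecs n \<Longrightarrow> mat_apply n B (M v) = v"
    using inverse by blast
  have left_inverse: "variety_automorphism.center n B (center z) = z" if z: "z < n" for z
  proof -
    have "star n (variety_automorphism.center n B (center z)) (mat_apply n B (M (spoke n z (\<lambda>_. 1))))"
      by (rule variety_automorphism.star_center[OF B(1) star_center[OF star_ones[OF z]]])
    then show ?thesis
      using star_center_unique[OF _ star_ones[OF z] n3] by (simp add: B(2) spoke_in_vecs)
  qed
  show ?thesis by (rule inj_on_inverseI[of _ "variety_automorphism.center n B"]) (simp add: left_inverse)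
qed

text \<open>The coordinate vector of an edge at \<open>j\<close> is half the difference of two stars
  centered at \<open>j\<close>, whose images share the center \<open>center j\<close>.\<close>

lemma M_unit_vec_off:
  assumes "j < n" "k < n" "j \<noteq> k" "p \<noteq> center j" "q \<noteq> center j"
  shows "M (unit_vec (edge j k)) (edge p q) = 0"
proof -
  let ?\<epsilon> = "\<lambda>_. 1 :: complex" and ?\<epsilon>' = "(\<lambda>_. 1 :: complex)(k := - 1)"
  have "star n j (spoke n j ?\<epsilon>')" using assms(1) by (rule star_spoke) simp
  note off = star_off[OF star_center[OF this] assms(4,5)] star_off[OF star_center[OF star_ones[OF assms(1)]] assms(4,5)]
  have "spoke n j ?\<epsilon> = (\<lambda>e. 1 * spoke n j ?\<epsilon>' e + 2 * 1 * unit_vec (edge j k) e)"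
    by (rule spoke_flip) (use assms in auto)
  then have "M (spoke n j ?\<epsilon>) = (\<lambda>e. 1 * M (spoke n j ?\<epsilon>') e + 2 * 1 * M (unit_vec (edge j k)) e)"
    by (simp only: mat_apply_linear)
  then have "M (spoke n j ?\<epsilon>) (edge p q) = 1 * M (spoke n j ?\<epsilon>') (edge p q) + 2 * 1 * M (unit_vec (edge j k)) (edge p q)"
    by (rule fun_cong)
  then show ?thesis unfolding off by simp
qed

text \<open>By the previous lemma at both ends of the edge, a non-zero entry can only occur in the
  row of the edge that contains both image centers.\<close>

lemma entry_zero:
  assumes "j < n" "k < n" "j \<noteq> k" "e \<in> edges n" "e \<noteq> edge (center j) (center k)"
  shows "A e (edge j k) = 0"
proof -
  obtain p q where pq: "e = (p, q)" "p < q" "q < n" using assms(4) by (rule edgesE)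
  then have e: "e = edge p q" by (simp add: edge_def)
  have "center j \<noteq> center k" using center_inj assms(1-3) by (auto simp: inj_on_def)
  then have "(p \<noteq> center j \<and> q \<noteq> center j) \<or> (p \<noteq> center k \<and> q \<noteq> center k)"
    using assms(5) e by (auto simp: edge_eq_iff)
  then have "M (unit_vec (edge j k)) e = 0"
    using M_unit_vec_off[of j k p q] M_unit_vec_off[of k j p q] assms(1-3) e by (auto simp: edge_commute[of k j])
  then show ?thesis using mat_apply_unit_vec[OF assms(4) edge_in_edges[OF assms(1-3)], of A] by simp
qed

text \<open>All other terms of the row vanish, so the entry is a value of the image of a star and is
  subject to \<open>star_squares\<close>.\<close>

lemma entry_on_star:
  assumes "j < n" "k < n" "j \<noteq> k"
  shows "M (spoke n j (\<lambda>_. 1)) (edge (center j) (center k)) = A (edge (center j) (center k)) (edge j k)"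
proof -
  let ?e = "edge (center j) (center k)"
  have e: "?e \<in> edges n"
    using assms center_less center_inj by (intro edge_in_edges) (auto simp: inj_on_def)
  have "M (spoke n j (\<lambda>_. 1)) ?e = (\<Sum>f\<in>edges n. A ?e f * spoke n j (\<lambda>_. 1) f)"
    using e by (simp add: mat_apply_def)
  also have "\<dots> = (\<Sum>f\<in>edges n. if f = edge j k then A ?e f else 0)"
  proof (rule sum.cong)
    fix f assume "f \<in> edges n"
    then obtain p q where pq: "f = (p, q)" "p < q" "q < n" by (rule edgesE)
    then have f: "f = edge p q" by (simp add: edge_def)
    show "A ?e f * spoke n j (\<lambda>_. 1) f = (if f = edge j k then A ?e f else 0)"
    proof (cases "f = edge j k")
      case True
      then show ?thesis using assms by (simp add: spoke_edge)
    next
      case False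
      have inj: "center x = center y \<longleftrightarrow> x = y" if "x < n" "y < n" for x y
        using inj_on_eq_iff[OF center_inj] that by simp
      have "?e \<noteq> edge (center p) (center q)"
        using False assms pq unfolding f edge_eq_iff by (auto simp: inj)
      then have "A ?e f = 0" unfolding f using pq e by (intro entry_zero) auto
      then show ?thesis using False by simp
    qed
  qed simp
  also have "\<dots> = A ?e (edge j k)" using edge_in_edges[OF assms] finite_edges[of n] by simp
  finally show ?thesis .
qed

text \<open>Entries for edges with a common vertex have equal squares, because the image of a star
  is a star. Any edge is linked to the edge \<open>01\<close> through vertex 0.\<close>

lemma entries_square:
  shows "\<exists>c. c \<noteq> 0 \<and> (\<forall>j<n. \<forall>k<n. j \<noteq> k \<longrightarrow> (A (edge (center j) (center k)) (edge j k))^2 = c^2)"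
proof -
  let ?\<alpha> = "\<lambda>j k. A (edge (center j) (center k)) (edge j k)"
  have sym: "?\<alpha> j k = ?\<alpha> k j" for j k by (simp only: edge_commute)
  have ne: "center k \<noteq> center j" if "j < n" "k < n" "j \<noteq> k" for j k
    using center_inj that by (auto simp: inj_on_def)
  have row: "(?\<alpha> j k)^2 = (?\<alpha> j h)^2" if "j < n" "k < n" "h < n" "j \<noteq> k" "j \<noteq> h" for j k h
    using star_squares[OF star_center[OF star_ones[OF that(1)]], of "center k" "center h"]
      center_less ne that by (simp add: entry_on_star)
  have nz: "?\<alpha> 0 1 \<noteq> 0"
    using star_on[OF star_center[OF star_ones[of 0]], of "center 1"] ne[of 0 1] center_less[of 1] n3
    by (simp add: entry_on_star)
  have "(?\<alpha> j k)^2 = (?\<alpha> 0 1)^2" if jk: "j < n" "k < n" "j \<noteq> k" for j k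
  proof (cases "j = 0")
    case True
    then show ?thesis using row[of 0 k 1] jk n3 by simp
  next
    case False
    then have "(?\<alpha> j k)^2 = (?\<alpha> j 0)^2" using row[of j k 0] jk by simp
    also have "\<dots> = (?\<alpha> 0 j)^2" by (simp only: sym)
    also have "\<dots> = (?\<alpha> 0 1)^2" using row[of 0 j 1] jk False n3 by simp
    finally show ?thesis .
  qed
  then show ?thesis using nz by blast
qed

end

theorem theorem1p1:
  fixes d n :: nat and A :: "nat \<times> nat \<Rightarrow> nat \<times> nat \<Rightarrow> complex"
  assumes "d \<ge> 1" and "n \<ge> d + 2" and "(d, n) \<noteq> (2, 4)"
    and "linear_automorphism n (unsq_meas_variety d n) A"
  shows "\<exists>c::complex. \<exists>s::nat \<times> nat \<Rightarrow> complex. \<exists>\<sigma>::nat \<Rightarrow> nat.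
           c \<noteq> 0 \<and> (\<forall>e\<in>edges n. s e \<in> {1, -1}) \<and> \<sigma> permutes {..<n} \<and>
           (\<forall>e\<in>edges n. \<forall>f\<in>edges n.
              A e f = c * s e * (if e = relabel_edge \<sigma> f then 1 else 0))"
proof -
  interpret variety_automorphism d n A using assms by unfold_locales
  \<comment> \<open>Extended by the identity, as \<open>permutes\<close> demands.\<close>
  define \<sigma> where "\<sigma> k = (if k < n then center k else k)" for k
  have relabel: "relabel_edge \<sigma> (edge j k) = edge (center j) (center k)" if "j < n" "k < n" for j k
    using that by (auto simp: relabel_edge_def edge_def \<sigma>_def min_def max_def)
  have "inj_on \<sigma> {..<n}" using center_inj by (auto simp: \<sigma>_def inj_on_def)
  moreover have "\<sigma> ` {..<n} \<subseteq> {..<n}" using center_less by (auto simp: \<sigma>_def)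
  ultimately have "bij_betw \<sigma> {..<n} {..<n}"
    by (simp add: bij_betw_def endo_inj_surj)
  then have perm: "\<sigma> permutes {..<n}"
    by (rule bij_imp_permutes) (simp add: \<sigma>_def)
  obtain c where c: "c \<noteq> 0"
    "\<forall>j<n. \<forall>k<n. j \<noteq> k \<longrightarrow> (A (edge (center j) (center k)) (edge j k))^2 = c^2"
    using entries_square by blast
  have entries: "(e \<noteq> relabel_edge \<sigma> f \<longrightarrow> A e f = 0) \<and> (A (relabel_edge \<sigma> f) f)^2 = c^2"
    if e: "e \<in> edges n" and "f \<in> edges n" for e f
  proof -
    obtain j k where "f = (j, k)" "j < k" "k < n" using \<open>f \<in> edges n\<close> by (rule edgesE)
    then have f: "f = edge j k" "j < n" "k < n" "j \<noteq> k" by (auto simp: edge_def)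
    show ?thesis
      unfolding f(1) relabel[OF f(2,3)] using entry_zero[OF f(2,3,4) e] c(2) f(2,3,4) by blast
  qed
  have inj: "inj_on (relabel_edge \<sigma>) (edges n)"
  proof (rule inj_onI)
    fix e f assume ef: "e \<in> edges n" "f \<in> edges n" "relabel_edge \<sigma> e = relabel_edge \<sigma> f"
    obtain i j where "e = (i, j)" "i < j" "j < n" using ef(1) by (rule edgesE)
    then have e: "e = edge i j" "i < n" "j < n" by (auto simp: edge_def)
    obtain k m where "f = (k, m)" "k < m" "m < n" using ef(2) by (rule edgesE)
    then have f: "f = edge k m" "k < n" "m < n" by (auto simp: edge_def)
    have "center x = center y \<longleftrightarrow> x = y" if "x < n" "y < n" for x y
      using inj_on_eq_iff[OF center_inj] that by simp
    then show "e = f"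
      using ef(3) e(2,3) f(2,3) unfolding e(1) f(1) relabel[OF e(2,3)] relabel[OF f(2,3)] edge_eq_iff by simp
  qed
  define g where "g = inv_into (edges n) (relabel_edge \<sigma>)"
  \<comment> \<open>The default 1 spares a proof that relabeling maps onto the edge set.\<close>
  define s where "s e = (if e \<in> relabel_edge \<sigma> ` edges n then A e (g e) / c else 1)" for e
  have "s e \<in> {1, -1}" if e: "e \<in> edges n" for e
  proof (cases "e \<in> relabel_edge \<sigma> ` edges n")
    case True
    then obtain f where f: "f \<in> edges n" "e = relabel_edge \<sigma> f" by blast
    then have "g e = f" using inj by (simp add: g_def)
    then have "(s e)^2 = 1" using entries[OF e f(1)] f c(1) by (simp add: s_def power_divide)
    then show ?thesis by (simp add: power2_eq_1_iff)
  qed (simp add: s_def)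
  moreover have "A e f = c * s e * (if e = relabel_edge \<sigma> f then 1 else 0)"
    if ef: "e \<in> edges n" "f \<in> edges n" for e f
  proof (cases "e = relabel_edge \<sigma> f")
    case True
    then have "g e = f" using inj ef(2) by (simp add: g_def)
    then show ?thesis using True ef(2) c(1) by (simp add: s_def)
  qed (use entries[OF ef] in simp)
  ultimately show ?thesis using c(1) perm by blast
qed

end
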